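(* Let $A$ be the generalized Weyl algebra of quantum type determined by $q$ and $p$, where $p$ has no multiple roots, and let $M$ be any $A$-bimodule. Let $\mathcal S^{\bullet}(M)$ and $\mathcal T^{\bullet}(M)[-2]$ be the cochain complexes, and $g\colon \mathcal S^{\bullet}(M)\to\mathcal T^{\bullet}(M)[-2]$, $f\colon\mathcal T^{\bullet}(M)[-2]\to\mathcal S^{\bullet}(M)$ the graded maps, given by the explicit matrices in the context. Then $f$ and $g$ are cochain maps and they are mutually quasi-inverse, i.e. $f\circ g$ is homotopic to the identity of $\mathcal S^{\bullet}(M)$ and $g\circ f$ is homotopic to the identity of $\mathcal T^{\bullet}(M)[-2]$. In particular $f$ and $g$ are both quasi-isomorphisms.
   Context: Algebra. $k$ is a field of characteristic $\neq 2$; $q\in k$, $q\neq 0,1$; $\sigma$ is the automorphism of $k[z]$ with $\sigma(z)=qz$, and $\widetilde\varphi:=\sigma(\varphi)$ for $\varphi\in k[z]$. $p\in k[z]$ has degree at least $1$ and no multiple roots (i.e. $p$ and its derivative $p'$ are coprime); fix $\alpha,\beta\in k[z]$ with $\alpha p+\beta p'=1$. $A=k\langle x,y,z\mid xz=qzx,\ yz=q^{-1}zy,\ yx=p,\ xy=\widetilde p\rangle$. Notation. $\otimes=\otimes_k$. $A^e=A\otimes A^{\mathrm{op}}$ has product $(a\otimes b)(a'\otimes b')=aa'\otimes b'b$, and an $A$-bimodule $M$ is a left $A^e$-module by $(a\otimes b)m=amb$. Let $\mathfrak d\colon k[z]\to k[z]\otimes k[z]$ be linear with $\mathfrak d(1)=0$,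 $\mathfrak d(z^i)=\sum_{j=1}^i z^{i-j}\otimes z^{j-1}$ for $i\ge1$. Write $\mathfrak d(p)=p_1\otimes p_2$ (summation understood), so e.g. $\widetilde{p_1}\otimes p_2=(\sigma\otimes\mathrm{id})\mathfrak d(p)$ and $p_1\otimes\beta p_2'$ is obtained from $\mathfrak d(p)$ by differentiating the second tensor factor and multiplying it by $\beta$; a tilde over a product means $\sigma$ applied to the product. Complexes. All elements of $M^r$ are column vectors, and matrices over $A^e$ act on them by left multiplication. $\mathcal S^{\bullet}(M)$ is $M\xrightarrow{d^0}M^3\xrightarrow{d^1}M^4\xrightarrow{d^2}M^4\xrightarrow{d^3}M^4\to\cdots$ (starting in degree $0$) with $$d^0=\begin{bmatrix}x\otimes1-1\otimes x\\ y\otimes1-1\otimes y\\ z\otimes1-1\otimes z\end{bmatrix},\quad d^1=\begin{bmatrix}y\otimes1&1\otimes x&-p_1\otimes p_2\\ 1\otimes y&x\otimes1&-q\widetilde{p_1}\otimes\widetilde{p_2}\\ \widetilde z\otimes1-1\otimes z&0&q\otimes x-x\otimes1\\ 0&z\otimes1-1\otimes\widetilde z&1\otimes y-y\otimes q\end{bmatrix},$$ $$d^2=\begin{bmatrix}x\otimes1&-1\otimes x&-\widetilde{p_1}\otimes p_2&0\\ -1\otimes y&y\otimes1&0&-p_1\otimes\widetilde{p_2}\\ z\otimes1-1\otimes z&0&-y\otimes1&-1\otimes x\\ 0&\widetilde z\otimes1-1\otimes\widetilde z&-1\otimes y&-x\otimes1\end{bmatrix},$$ $$d^3=\begin{bmatrix}y\otimes1&1\otimes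 x&-p_1\otimes p_2&0\\ 1\otimes y&x\otimes1&0&-\widetilde{p_1}\otimes\widetilde{p_2}\\ \widetilde z\otimes1-1\otimes z&0&-x\otimes1&1\otimes x\\ 0&z\otimes1-1\otimes\widetilde z&1\otimes y&-y\otimes1\end{bmatrix},$$ and $d^i=d^{i-2}$ for $i\ge4$. (It computes $\mathrm{Ext}_{A^e}^\bullet(A,M)$.) $\mathcal T^{\bullet}(M)$ is $\cdots\to M^4\xrightarrow{\partial^{-4}}M^4\xrightarrow{\partial^{-3}}M^4\xrightarrow{\partial^{-2}}M^3\xrightarrow{\partial^{-1}}M$, where $\mathcal T^{0}(M)=M$, $\mathcal T^{-1}(M)=M^3$, $\mathcal T^{-i}(M)=M^4$ for $i\ge2$, $\partial^{-i}\colon\mathcal T^{-i}(M)\to\mathcal T^{-i+1}(M)$, with $$\partial^{-1}=\begin{bmatrix}q\otimes x-x\otimes1&q^{-1}\otimes y-y\otimes1&1\otimes z-z\otimes1\end{bmatrix},$$ $$\partial^{-2}=\begin{bmatrix}q^{-1}\otimes y&y\otimes1&1\otimes\widetilde z-z\otimes1&0\\ x\otimes1&q\otimes x&0&1\otimes z-\widetilde z\otimes1\\ -p_1\otimes p_2&-q\widetilde{p_1}\otimes\widetilde{p_2}&x\otimes q-q\otimes x&y\otimes1-1\otimes y\end{bmatrix},$$ $$\partial^{-3}=\begin{bmatrix}q\otimes x&-y\otimes1&1\otimes z-z\otimes1&0\\ -x\otimes1&q^{-1}\otimes y&0&1\otimes\widetilde z-\widetilde z\otimes1\\ -p_1\otimes\widetilde{p_2}&0&-q^{-1}\otimes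 y&-y\otimes1\\ 0&-\widetilde{p_1}\otimes p_2&-x\otimes1&-q\otimes x\end{bmatrix},$$ $$\partial^{-4}=\begin{bmatrix}q^{-1}\otimes y&y\otimes1&1\otimes\widetilde z-z\otimes1&0\\ x\otimes1&q\otimes x&0&1\otimes z-\widetilde z\otimes1\\ -p_1\otimes p_2&0&-q\otimes x&y\otimes1\\ 0&-\widetilde{p_1}\otimes\widetilde{p_2}&x\otimes1&-q^{-1}\otimes y\end{bmatrix},$$ and $\partial^{-i}=\partial^{-i+2}$ for $i\ge5$. (It computes $\mathrm{Tor}^{A^e}_\bullet(M^\nu,A)$, where $\nu(x)=qx$, $\nu(y)=q^{-1}y$, $\nu(z)=z$ and $M^\nu$ is $M$ with right action twisted by $\nu$.) The shifted complex $\mathcal T^{\bullet}(M)[-2]$ has $\mathcal T^{i-2}(M)$ in degree $i$ and differential $\partial^{i}_{[-2]}=\partial^{i-2}$. Maps. $g^i\colon\mathcal S^i(M)\to\mathcal T^{i-2}(M)$ and $f^i\colon\mathcal T^{i-2}(M)\to\mathcal S^i(M)$ are zero for $i\notin\{0,1,2\}$ and $$g^0=\begin{bmatrix}1\otimes\beta\\ -q^{-1}\otimes\widetilde\beta\\ q^{-1}\otimes\alpha y\\ 0\end{bmatrix},\quad g^1=\begin{bmatrix}0&-q^{-1}\otimes\widetilde\beta&-q^{-1}\otimes\alpha y\\ 1\otimes\beta&0&0\\ 1\otimes\alpha y&0&q\widetilde{p_1}\otimes\widetilde{\beta p_2'}-p_1\otimes\beta p_2'\end{bmatrix},$$ $$g^2=\begin{bmatrix}-1\otimes\beta&q^{-1}\otimes\widetilde\beta&-q^{-1}\otimes\alpha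 y&0\end{bmatrix},\quad f^0=\begin{bmatrix}p_1\otimes p_2&0&q\otimes x&-y\otimes1\end{bmatrix},$$ $$f^1=\begin{bmatrix}0&\widetilde{p_1}\otimes p_2&1\otimes x\\ -qp_1\otimes\widetilde{p_2}&0&-y\otimes1\\ -q\otimes x&y\otimes1&0\end{bmatrix},\quad f^2=\begin{bmatrix}0\\ q\widetilde{p_1}\otimes\widetilde{p_2}\\ -q\otimes x\\ y\otimes q\end{bmatrix}.$$ *)

theory Defs
  imports
    "HOL-Algebra.Algebraic_Closure_Type"
    "HOL-Algebra.QuotRing"
    "HOL-Library.Poly_Mapping"
    "HOL-Computational_Algebra.Polynomial"
    "Jordan_Normal_Form.Matrix"
begin

section \<open>Cochain complexes over a commutative ring\<close>

record ('k, 'v) cochain =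
  cobj :: "int \<Rightarrow> ('k, 'v) module"
  cdiff :: "int \<Rightarrow> 'v \<Rightarrow> 'v"

definition lin_hom ::
  "'k ring \<Rightarrow> ('k, 'v) module \<Rightarrow> ('k, 'w) module \<Rightarrow> ('v \<Rightarrow> 'w) set" where
  "lin_hom K M N = {h \<in> carrier M \<rightarrow> carrier N.
     (\<forall>u\<in>carrier M. \<forall>v\<in>carrier M. h (u \<oplus>\<^bsub>M\<^esub> v) = h u \<oplus>\<^bsub>N\<^esub> h v) \<and>
     (\<forall>c\<in>carrier K. \<forall>v\<in>carrier M. h (c \<odot>\<^bsub>M\<^esub> v) = c \<odot>\<^bsub>N\<^esub> h v)}"

definition cochain_complex :: "'k ring \<Rightarrow> ('k, 'v) cochain \<Rightarrow> bool" where
  "cochain_complex K C \<longleftrightarrow>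
     (\<forall>i. Module.module K (cobj C i)) \<and>
     (\<forall>i. cdiff C i \<in> lin_hom K (cobj C i) (cobj C (i + 1))) \<and>
     (\<forall>i. \<forall>v\<in>carrier (cobj C i). cdiff C (i + 1) (cdiff C i v) = \<zero>\<^bsub>cobj C (i + 2)\<^esub>)"

definition cochain_map ::
  "'k ring \<Rightarrow> ('k, 'v) cochain \<Rightarrow> ('k, 'w) cochain \<Rightarrow> (int \<Rightarrow> 'v \<Rightarrow> 'w) \<Rightarrow> bool" where
  "cochain_map K C D f \<longleftrightarrow>
     (\<forall>i. f i \<in> lin_hom K (cobj C i) (cobj D i)) \<and>
     (\<forall>i. \<forall>v\<in>carrier (cobj C i). f (i + 1) (cdiff C i v) = cdiff D i (f i v))"

definition homotopic_maps ::
  "'k ring \<Rightarrow> ('k, 'v) cochain \<Rightarrow> ('k, 'w) cochain \<Rightarrow>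
   (int \<Rightarrow> 'v \<Rightarrow> 'w) \<Rightarrow> (int \<Rightarrow> 'v \<Rightarrow> 'w) \<Rightarrow> bool" where
  "homotopic_maps K C D f g \<longleftrightarrow>
     (\<exists>h. (\<forall>i. h i \<in> lin_hom K (cobj C i) (cobj D (i - 1))) \<and>
          (\<forall>i. \<forall>v\<in>carrier (cobj C i).
             f i v = g i v \<oplus>\<^bsub>cobj D i\<^esub>
               (cdiff D (i - 1) (h i v) \<oplus>\<^bsub>cobj D i\<^esub> h (i + 1) (cdiff C i v))))"

definition cocycles :: "('k, 'v) cochain \<Rightarrow> int \<Rightarrow> 'v set" where
  "cocycles C i = {v \<in> carrier (cobj C i). cdiff C i v = \<zero>\<^bsub>cobj C (i + 1)\<^esub>}"

definition coboundaries :: "('k, 'v) cochain \<Rightarrow> int \<Rightarrow> 'v set" where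
  "coboundaries C i = cdiff C (i - 1) ` carrier (cobj C (i - 1))"

definition cohomology :: "('k, 'v) cochain \<Rightarrow> int \<Rightarrow> 'v set monoid" where
  "cohomology C i = (cobj C i)\<lparr>carrier := cocycles C i\<rparr> A_Mod coboundaries C i"

text \<open>For a cochain map \<open>f\<close> from \<open>C\<close> to \<open>D\<close> and a class \<open>c = B\<^sup>i(C) + v\<close>, the set
  below is \<open>B\<^sup>i(D) + f\<^sup>i(v)\<close>, so this is the map that \<open>f\<close> induces on cohomology.
  It is automatically linear; an isomorphism of modules is the same as a bijective
  additive map.\<close>

definition cohomology_map ::
  "('k, 'w) cochain \<Rightarrow> (int \<Rightarrow> 'v \<Rightarrow> 'w) \<Rightarrow> int \<Rightarrow> 'v set \<Rightarrow> 'w set" where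
  "cohomology_map D f i c = set_add (cobj D i) (coboundaries D i) (f i ` c)"

definition quasi_isomorphism ::
  "'k ring \<Rightarrow> ('k, 'v) cochain \<Rightarrow> ('k, 'w) cochain \<Rightarrow> (int \<Rightarrow> 'v \<Rightarrow> 'w) \<Rightarrow> bool" where
  "quasi_isomorphism K C D f \<longleftrightarrow> cochain_map K C D f \<and>
     (\<forall>i. cohomology_map D f i \<in> iso (cohomology C i) (cohomology D i))"

text \<open>The degree shift does not change the sign of the differential.\<close>

definition cshift :: "('k, 'v) cochain \<Rightarrow> int \<Rightarrow> ('k, 'v) cochain" where
  "cshift C n = \<lparr>cobj = (\<lambda>i. cobj C (i + n)), cdiff = (\<lambda>i. cdiff C (i + n))\<rparr>"


section \<open>Bimodules and matrices over the enveloping algebra\<close>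

text \<open>Bimodules over an algebra \<open>R\<close> with structure map \<open>\<eta>\<close> from the base field. The last
  axiom says that the two induced actions of the base field agree, as they do for a left
  module over the tensor product of \<open>R\<close> and its opposite over the base field.\<close>

locale central_bimodule =
  fixes R :: "('a, 'r) ring_scheme" (structure)
    and \<eta> :: "'k :: field \<Rightarrow> 'a"
    and lact :: "'a \<Rightarrow> 'm :: ab_group_add \<Rightarrow> 'm"
    and ract :: "'m \<Rightarrow> 'a \<Rightarrow> 'm"
  assumes lact_add: "a \<in> carrier R \<Longrightarrow> lact a (m + n) = lact a m + lact a n"
    and add_lact: "a \<in> carrier R \<Longrightarrow> b \<in> carrier R \<Longrightarrow> lact (a \<oplus> b) m = lact a m + lact b m"
    and mult_lact: "a \<in> carrier R \<Longrightarrow> b \<in> carrier R \<Longrightarrow> lact (a \<otimes> b) m = lact a (lact b m)"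
    and one_lact: "lact \<one> m = m"
    and ract_add: "a \<in> carrier R \<Longrightarrow> ract (m + n) a = ract m a + ract n a"
    and add_ract: "a \<in> carrier R \<Longrightarrow> b \<in> carrier R \<Longrightarrow> ract m (a \<oplus> b) = ract m a + ract m b"
    and mult_ract: "a \<in> carrier R \<Longrightarrow> b \<in> carrier R \<Longrightarrow> ract m (a \<otimes> b) = ract (ract m a) b"
    and one_ract: "ract m \<one> = m"
    and lact_ract: "a \<in> carrier R \<Longrightarrow> b \<in> carrier R \<Longrightarrow> ract (lact a m) b = lact a (ract m b)"
    and scalar_central: "lact (\<eta> c) m = ract m (\<eta> c)"

text \<open>Elements of a tensor product over the field \<open>'k\<close> are written as formal linear
  combinations of pure tensors, i.e. as elements of the free vector space on pairs of which
  the tensor product is the quotient by the bilinearity relations. Everything done with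
  them below (\<open>tens_map\<close> for linear maps, \<open>env_act\<close>) is compatible with these relations
  and hence is determined by the element of the tensor product.\<close>

type_synonym ('k, 'a, 'b) tens = "('a \<times> 'b) \<Rightarrow>\<^sub>0 'k"

definition tens :: "'a \<Rightarrow> 'b \<Rightarrow> ('k :: field, 'a, 'b) tens" (infix "\<boxtimes>" 75) where
  "a \<boxtimes> b = Poly_Mapping.single (a, b) 1"

definition tens_map ::
  "('a \<Rightarrow> 'c) \<Rightarrow> ('b \<Rightarrow> 'd) \<Rightarrow> ('k :: field, 'a, 'b) tens \<Rightarrow> ('k, 'c, 'd) tens" where
  "tens_map \<phi> \<psi> t =
     (\<Sum>(a, b)\<in>Poly_Mapping.keys t. Poly_Mapping.single (\<phi> a, \<psi> b) (Poly_Mapping.lookup t (a, b)))"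

text \<open>The action \<open>(a \<otimes> b) m = a m b\<close> of the enveloping algebra, extended linearly, and the
  resulting action of matrices on column vectors.\<close>

definition env_act ::
  "('k :: field \<Rightarrow> 'a) \<Rightarrow> ('a \<Rightarrow> 'm :: ab_group_add \<Rightarrow> 'm) \<Rightarrow> ('m \<Rightarrow> 'a \<Rightarrow> 'm) \<Rightarrow>
   ('k, 'a, 'a) tens \<Rightarrow> 'm \<Rightarrow> 'm" where
  "env_act \<eta> lact ract t m =
     (\<Sum>(a, b)\<in>Poly_Mapping.keys t. lact (\<eta> (Poly_Mapping.lookup t (a, b))) (ract (lact a m) b))"

definition mat_act ::
  "('k :: field \<Rightarrow> 'a) \<Rightarrow> ('a \<Rightarrow> 'm :: ab_group_add \<Rightarrow> 'm) \<Rightarrow> ('m \<Rightarrow> 'a \<Rightarrow> 'm) \<Rightarrow>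
   ('k, 'a, 'a) tens mat \<Rightarrow> 'm vec \<Rightarrow> 'm vec" where
  "mat_act \<eta> lact ract E v =
     vec (dim_row E) (\<lambda>i. \<Sum>j<dim_col E. env_act \<eta> lact ract (E $$ (i, j)) (v $ j))"

definition vec_module ::
  "('k :: field \<Rightarrow> 'a) \<Rightarrow> ('a \<Rightarrow> 'm :: ab_group_add \<Rightarrow> 'm) \<Rightarrow> nat \<Rightarrow> ('k, 'm vec) module" where
  "vec_module \<eta> lact r =
     \<lparr>carrier = carrier_vec r, monoid.mult = undefined, one = undefined,
      zero = 0\<^sub>v r, add = (+), module.smult = (\<lambda>c. map_vec (lact (\<eta> c)))\<rparr>"


section \<open>Generalized Weyl algebras of quantum type\<close>

text \<open>The free algebra on three generators is the monoid algebra of the monoid of words.\<close>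

instantiation list :: (type) monoid_add
begin
definition zero_list :: "'a list" where "0 = []"
definition plus_list :: "'a list \<Rightarrow> 'a list \<Rightarrow> 'a list" where "xs + ys = xs @ ys"
instance by standard (simp_all add: zero_list_def plus_list_def)
end

datatype gen = Gen_x | Gen_y | Gen_z

type_synonym 'k free_alg = "gen list \<Rightarrow>\<^sub>0 'k"

definition free_gen :: "gen \<Rightarrow> 'k :: field free_alg" where
  "free_gen a = Poly_Mapping.single [a] 1"

definition free_scalar :: "'k :: field \<Rightarrow> 'k free_alg" where
  "free_scalar c = Poly_Mapping.single [] c"

definition free_poly :: "'k :: field poly \<Rightarrow> 'k free_alg" where
  "free_poly \<phi> =
     (\<Sum>i\<le>Polynomial.degree \<phi>. Poly_Mapping.single (replicate i Gen_z) (poly.coeff \<phi> i))"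

definition twist :: "'k :: field \<Rightarrow> 'k poly \<Rightarrow> 'k poly" where
  "twist q \<phi> = pcompose \<phi> [:0, q:]"

definition dpoly :: "'k :: field poly \<Rightarrow> ('k, 'k poly, 'k poly) tens" where
  "dpoly \<phi> = (\<Sum>i\<le>Polynomial.degree \<phi>. \<Sum>j=1..i.
     Poly_Mapping.single (Polynomial.monom 1 (i - j), Polynomial.monom 1 (j - 1)) (poly.coeff \<phi> i))"

context
  fixes q :: "'k :: field" and p \<alpha> \<beta> :: "'k poly"
begin

definition gwa_relators :: "'k free_alg set" where
  "gwa_relators =
    {free_gen Gen_x * free_gen Gen_z - free_scalar q * free_gen Gen_z * free_gen Gen_x,
     free_gen Gen_y * free_gen Gen_z - free_scalar (inverse q) * free_gen Gen_z * free_gen Gen_y,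
     free_gen Gen_y * free_gen Gen_x - free_poly p,
     free_gen Gen_x * free_gen Gen_y - free_poly (twist q p)}"

definition gwa_ideal :: "'k free_alg set" where
  "gwa_ideal = Idl\<^bsub>ring_of_type_algebra\<^esub> gwa_relators"

definition gwa :: "'k free_alg set ring" where
  "gwa = ring_of_type_algebra Quot gwa_ideal"

definition gwa_class :: "'k free_alg \<Rightarrow> 'k free_alg set" where
  "gwa_class u = gwa_ideal +>\<^bsub>ring_of_type_algebra\<^esub> u"

definition gscal :: "'k \<Rightarrow> 'k free_alg set" where "gscal c = gwa_class (free_scalar c)"
definition gpol :: "'k poly \<Rightarrow> 'k free_alg set" where "gpol \<phi> = gwa_class (free_poly \<phi>)"
definition gx :: "'k free_alg set" where "gx = gwa_class (free_gen Gen_x)"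
definition gy :: "'k free_alg set" where "gy = gwa_class (free_gen Gen_y)"
definition gz :: "'k free_alg set" where "gz = gwa_class (free_gen Gen_z)"
definition gzt :: "'k free_alg set" where "gzt = gpol (twist q [:0, 1:])"
definition gunit :: "'k free_alg set" where "gunit = \<one>\<^bsub>gwa\<^esub>"

text \<open>\<open>p12 \<phi> \<psi>\<close> is \<open>\<phi>(p\<^sub>1) \<otimes> \<psi>(p\<^sub>2)\<close>, where \<open>p\<^sub>1 \<otimes> p\<^sub>2\<close> is \<open>dpoly p\<close> in Sweedler
  notation.\<close>

definition p12 :: "('k poly \<Rightarrow> 'k poly) \<Rightarrow> ('k poly \<Rightarrow> 'k poly) \<Rightarrow>
    ('k, 'k free_alg set, 'k free_alg set) tens" where
  "p12 \<phi> \<psi> = tens_map (\<lambda>u. gpol (\<phi> u)) (\<lambda>v. gpol (\<psi> v)) (dpoly p)"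

type_synonym 'c env_mat = "('c, 'c free_alg set, 'c free_alg set) tens mat"

definition S_d0 :: "'k env_mat" where
  "S_d0 = mat_of_rows_list 1
    [[gx \<boxtimes> gunit - gunit \<boxtimes> gx],
     [gy \<boxtimes> gunit - gunit \<boxtimes> gy],
     [gz \<boxtimes> gunit - gunit \<boxtimes> gz]]"

definition S_d1 :: "'k env_mat" where
  "S_d1 = mat_of_rows_list 3
    [[gy \<boxtimes> gunit,               gunit \<boxtimes> gx,               - p12 id id],
     [gunit \<boxtimes> gy,               gx \<boxtimes> gunit,               - p12 (\<lambda>u. Polynomial.smult q (twist q u)) (twist q)],
     [gzt \<boxtimes> gunit - gunit \<boxtimes> gz, 0,                        gscal q \<boxtimes> gx - gx \<boxtimes> gunit],
     [0,                        gz \<boxtimes> gunit - gunit \<boxtimes> gzt, gunit \<boxtimes> gy - gy \<boxtimes> gscal q]]"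

definition S_d2 :: "'k env_mat" where
  "S_d2 = mat_of_rows_list 4
    [[gx \<boxtimes> gunit,              - (gunit \<boxtimes> gx),            - p12 (twist q) id, 0],
     [- (gunit \<boxtimes> gy),          gy \<boxtimes> gunit,                0,                  - p12 id (twist q)],
     [gz \<boxtimes> gunit - gunit \<boxtimes> gz, 0,                         - (gy \<boxtimes> gunit),     - (gunit \<boxtimes> gx)],
     [0,                       gzt \<boxtimes> gunit - gunit \<boxtimes> gzt, - (gunit \<boxtimes> gy),     - (gx \<boxtimes> gunit)]]"

definition S_d3 :: "'k env_mat" where
  "S_d3 = mat_of_rows_list 4
    [[gy \<boxtimes> gunit,               gunit \<boxtimes> gx,               - p12 id id,    0],
     [gunit \<boxtimes> gy,               gx \<boxtimes> gunit,               0,              - p12 (twist q) (twist q)],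
     [gzt \<boxtimes> gunit - gunit \<boxtimes> gz, 0,                        - (gx \<boxtimes> gunit), gunit \<boxtimes> gx],
     [0,                        gz \<boxtimes> gunit - gunit \<boxtimes> gzt, gunit \<boxtimes> gy,     - (gy \<boxtimes> gunit)]]"

definition S_rank :: "int \<Rightarrow> nat" where
  "S_rank i = (if i < 0 then 0 else if i = 0 then 1 else if i = 1 then 3 else 4)"

definition S_mat :: "int \<Rightarrow> 'k env_mat" where
  "S_mat i = (if i < 0 then 0\<^sub>m (S_rank (i + 1)) (S_rank i)
     else if i = 0 then S_d0 else if i = 1 then S_d1
     else if even i then S_d2 else S_d3)"

definition T_d1 :: "'k env_mat" where
  "T_d1 = mat_of_rows_list 3
    [[gscal q \<boxtimes> gx - gx \<boxtimes> gunit, gscal (inverse q) \<boxtimes> gy - gy \<boxtimes> gunit, gunit \<boxtimes> gz - gz \<boxtimes> gunit]]"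

definition T_d2 :: "'k env_mat" where
  "T_d2 = mat_of_rows_list 4
    [[gscal (inverse q) \<boxtimes> gy, gy \<boxtimes> gunit, gunit \<boxtimes> gzt - gz \<boxtimes> gunit, 0],
     [gx \<boxtimes> gunit, gscal q \<boxtimes> gx, 0, gunit \<boxtimes> gz - gzt \<boxtimes> gunit],
     [- p12 id id, - p12 (\<lambda>u. Polynomial.smult q (twist q u)) (twist q),
      gx \<boxtimes> gscal q - gscal q \<boxtimes> gx, gy \<boxtimes> gunit - gunit \<boxtimes> gy]]"

definition T_d3 :: "'k env_mat" where
  "T_d3 = mat_of_rows_list 4
    [[gscal q \<boxtimes> gx,       - (gy \<boxtimes> gunit),         gunit \<boxtimes> gz - gz \<boxtimes> gunit,    0],
     [- (gx \<boxtimes> gunit),     gscal (inverse q) \<boxtimes> gy, 0,                          gunit \<boxtimes> gzt - gzt \<boxtimes> gunit],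
     [- p12 id (twist q), 0,                      - (gscal (inverse q) \<boxtimes> gy), - (gy \<boxtimes> gunit)],
     [0,                  - p12 (twist q) id,     - (gx \<boxtimes> gunit),             - (gscal q \<boxtimes> gx)]]"

definition T_d4 :: "'k env_mat" where
  "T_d4 = mat_of_rows_list 4
    [[gscal (inverse q) \<boxtimes> gy, gy \<boxtimes> gunit,                gunit \<boxtimes> gzt - gz \<boxtimes> gunit, 0],
     [gx \<boxtimes> gunit,             gscal q \<boxtimes> gx,              0,                        gunit \<boxtimes> gz - gzt \<boxtimes> gunit],
     [- p12 id id,            0,                         - (gscal q \<boxtimes> gx),         gy \<boxtimes> gunit],
     [0,                      - p12 (twist q) (twist q), gx \<boxtimes> gunit,               - (gscal (inverse q) \<boxtimes> gy)]]"

definition T_rank :: "int \<Rightarrow> nat" where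
  "T_rank i = (if i > 0 then 0 else if i = 0 then 1 else if i = -1 then 3 else 4)"

definition T_mat :: "int \<Rightarrow> 'k env_mat" where
  "T_mat i = (if i \<ge> 0 then 0\<^sub>m (T_rank (i + 1)) (T_rank i)
     else if i = -1 then T_d1 else if i = -2 then T_d2
     else if odd i then T_d3 else T_d4)"

definition g_mat :: "int \<Rightarrow> 'k env_mat" where
  "g_mat i =
    (if i = 0 then mat_of_rows_list 1
       [[gunit \<boxtimes> gpol \<beta>],
        [- (gscal (inverse q) \<boxtimes> gpol (twist q \<beta>))],
        [gscal (inverse q) \<boxtimes> (gpol \<alpha> \<otimes>\<^bsub>gwa\<^esub> gy)],
        [0]]
     else if i = 1 then mat_of_rows_list 3
       [[0, - (gscal (inverse q) \<boxtimes> gpol (twist q \<beta>)),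
            - (gscal (inverse q) \<boxtimes> (gpol \<alpha> \<otimes>\<^bsub>gwa\<^esub> gy))],
        [gunit \<boxtimes> gpol \<beta>, 0, 0],
        [gunit \<boxtimes> (gpol \<alpha> \<otimes>\<^bsub>gwa\<^esub> gy), 0,
           p12 (\<lambda>u. Polynomial.smult q (twist q u)) (\<lambda>v. twist q (\<beta> * pderiv v))
           - p12 id (\<lambda>v. \<beta> * pderiv v)]]
     else if i = 2 then mat_of_rows_list 4
       [[- (gunit \<boxtimes> gpol \<beta>), gscal (inverse q) \<boxtimes> gpol (twist q \<beta>),
         - (gscal (inverse q) \<boxtimes> (gpol \<alpha> \<otimes>\<^bsub>gwa\<^esub> gy)), 0]]
     else 0\<^sub>m (T_rank (i - 2)) (S_rank i))"

definition f_mat :: "int \<Rightarrow> 'k env_mat" where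
  "f_mat i =
    (if i = 0 then mat_of_rows_list 4
       [[p12 id id, 0, gscal q \<boxtimes> gx, - (gy \<boxtimes> gunit)]]
     else if i = 1 then mat_of_rows_list 3
       [[0, p12 (twist q) id, gunit \<boxtimes> gx],
        [- p12 (Polynomial.smult q) (twist q), 0, - (gy \<boxtimes> gunit)],
        [- (gscal q \<boxtimes> gx), gy \<boxtimes> gunit, 0]]
     else if i = 2 then mat_of_rows_list 1
       [[0],
        [p12 (\<lambda>u. Polynomial.smult q (twist q u)) (twist q)],
        [- (gscal q \<boxtimes> gx)],
        [gy \<boxtimes> gscal q]]
     else 0\<^sub>m (S_rank i) (T_rank (i - 2)))"

context
  fixes lact :: "'k free_alg set \<Rightarrow> 'm :: ab_group_add \<Rightarrow> 'm"
    and ract :: "'m \<Rightarrow> 'k free_alg set \<Rightarrow> 'm"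
begin

definition gwa_bimodule :: bool where
  "gwa_bimodule \<longleftrightarrow> central_bimodule gwa gscal lact ract"

definition S_complex :: "('k, 'm vec) cochain" where
  "S_complex = \<lparr>cobj = (\<lambda>i. vec_module gscal lact (S_rank i)),
                cdiff = (\<lambda>i. mat_act gscal lact ract (S_mat i))\<rparr>"

definition T_complex :: "('k, 'm vec) cochain" where
  "T_complex = \<lparr>cobj = (\<lambda>i. vec_module gscal lact (T_rank i)),
                cdiff = (\<lambda>i. mat_act gscal lact ract (T_mat i))\<rparr>"

definition g_map :: "int \<Rightarrow> 'm vec \<Rightarrow> 'm vec" where
  "g_map i = mat_act gscal lact ract (g_mat i)"

definition f_map :: "int \<Rightarrow> 'm vec \<Rightarrow> 'm vec" where
  "f_map i = mat_act gscal lact ract (f_mat i)"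

end

end

end

theory Submission
  imports Defs
begin

text \<open>
  On a bimodule, let the commutative ring \<open>k[z, w]\<close> act by \<open>z\<close> on the left and by \<open>w\<close> on the
  right. Then \<open>p\<^sub>1 \<otimes> p\<^sub>2\<close> acts as the divided difference \<open>D(z, w) = (p(z) - p(w)) / (z - w)\<close>,
  and \<open>p\<^sub>1 \<otimes> \<beta> p\<^sub>2'\<close> acts as \<open>e(z, w) = \<beta>(w) \<partial>D/\<partial>w\<close>. Since
  \<open>(z - w) \<partial>D/\<partial>w = D - p'(w)\<close>, the hypothesis \<open>\<alpha> p + \<beta> p' = 1\<close> gives
  \<open>\<alpha>(w) p(w) + \<beta>(w) D(z, w) - (z - w) e(z, w) = 1\<close>. Homotopies are obtained by pairing, with
  suitable signs and \<open>q\<close>-twists, the entries \<open>1 \<otimes> x\<close> of the differentials with \<open>1 \<otimes> \<alpha> y\<close>,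
  the entries \<open>p\<^sub>1 \<otimes> p\<^sub>2\<close> with \<open>1 \<otimes> \<beta>\<close> and the entries \<open>z \<otimes> 1 - 1 \<otimes> z\<close> with \<open>e\<close>.
  All matrix identities are then checked by moving the four operators given by left and right
  multiplication with \<open>x\<close> and \<open>y\<close> to the right of the polynomials in \<open>z\<close> and \<open>w\<close>, and
  reducing \<open>z D\<close> and \<open>z e\<close> with the relations above.
\<close>

section \<open>Homotopy equivalences are quasi-isomorphisms\<close>

text \<open>Gives access to the library facts on homomorphisms of abelian groups; cohomology is
  treated here additively only.\<close>

lemma lin_hom_abelian_group_hom:
  assumes "h \<in> lin_hom K M N" "abelian_group M" "abelian_group N"
  shows "abelian_group_hom M N h"
proof (rule abelian_group_homI[OF assms(2,3)])
  show "group_hom (add_monoid M) (add_monoid N) h"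
    using assms abelian_group.a_group[OF assms(2)] abelian_group.a_group[OF assms(3)]
    by (auto simp: group_hom_def group_hom_axioms_def hom_def lin_hom_def)
qed

lemma additive_subgroup_image:
  assumes "abelian_group_hom M N h"
  shows "additive_subgroup (h ` carrier M) N"
proof -
  interpret abelian_group_hom M N h by fact
  show ?thesis
    using group_hom.img_is_subgroup[OF a_group_hom] by (auto intro: additive_subgroupI)
qed

lemma cocycles_carrier: "v \<in> cocycles C i \<Longrightarrow> v \<in> carrier (cobj C i)"
  by (simp add: cocycles_def)

lemma carrier_cohomology:
  "carrier (cohomology C i) = (\<lambda>v. coboundaries C i +>\<^bsub>cobj C i\<^esub> v) ` cocycles C i"
  by (auto simp: cohomology_def A_FactGroup_def' A_RCOSETS_def' a_r_coset_def' a_r_coset_defs A_RCOSETS_defs)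

lemma mult_cohomology:
  "c \<otimes>\<^bsub>cohomology C i\<^esub> d = c <+>\<^bsub>cobj C i\<^esub> d"
  by (simp add: cohomology_def set_add_def set_mult_def)

context
  fixes K :: "'k ring" and C :: "('k, 'v) cochain"
  assumes cpx: "cochain_complex K C"
begin

lemma abelian_group_cobj: "abelian_group (cobj C i)"
  using cpx by (auto simp: cochain_complex_def Module.module_def)

lemma cdiff_hom: "abelian_group_hom (cobj C i) (cobj C (i + 1)) (cdiff C i)"
  using cpx by (intro lin_hom_abelian_group_hom[where K = K] abelian_group_cobj) (auto simp: cochain_complex_def)

lemma cdiff_hom': "abelian_group_hom (cobj C (i - 1)) (cobj C i) (cdiff C (i - 1))"
  using cdiff_hom[of "i - 1"] by simp

lemma cdiff_cdiff: "v \<in> carrier (cobj C (i - 1)) \<Longrightarrow> cdiff C i (cdiff C (i - 1) v) = \<zero>\<^bsub>cobj C (i + 1)\<^esub>"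
proof -
  assume "v \<in> carrier (cobj C (i - 1))"
  then have "cdiff C (i - 1 + 1) (cdiff C (i - 1) v) = \<zero>\<^bsub>cobj C (i - 1 + 2)\<^esub>"
    using cpx unfolding cochain_complex_def by blast
  moreover have "i - 1 + 2 = i + 1" by simp
  ultimately show ?thesis by simp
qed

lemma abelian_subgroup_coboundaries: "abelian_subgroup (coboundaries C i) (cobj C i)"
  unfolding coboundaries_def
  by (intro abelian_subgroupI3 additive_subgroup_image cdiff_hom' abelian_group_cobj)

lemma cocycles_add:
  assumes "u \<in> cocycles C i" "v \<in> cocycles C i"
  shows "u \<oplus>\<^bsub>cobj C i\<^esub> v \<in> cocycles C i"
proof -
  interpret abelian_group_hom "cobj C i" "cobj C (i + 1)" "cdiff C i" by (rule cdiff_hom)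
  show ?thesis using assms by (simp add: cocycles_def)
qed

lemma coset_add:
  "u \<in> cocycles C i \<Longrightarrow> v \<in> cocycles C i \<Longrightarrow>
    (coboundaries C i +>\<^bsub>cobj C i\<^esub> u) <+>\<^bsub>cobj C i\<^esub> (coboundaries C i +>\<^bsub>cobj C i\<^esub> v)
     = coboundaries C i +>\<^bsub>cobj C i\<^esub> (u \<oplus>\<^bsub>cobj C i\<^esub> v)"
  by (rule abelian_subgroup.a_rcos_sum[OF abelian_subgroup_coboundaries]) (auto dest: cocycles_carrier)

lemma coset_eqI:
  assumes "b \<in> coboundaries C i" "v \<in> carrier (cobj C i)"
  shows "coboundaries C i +>\<^bsub>cobj C i\<^esub> (b \<oplus>\<^bsub>cobj C i\<^esub> v) = coboundaries C i +>\<^bsub>cobj C i\<^esub> v"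
proof -
  interpret abelian_subgroup "coboundaries C i" "cobj C i" by (rule abelian_subgroup_coboundaries)
  have "b \<oplus>\<^bsub>cobj C i\<^esub> v \<in> coboundaries C i +>\<^bsub>cobj C i\<^esub> v"
    using assms by (auto simp: a_r_coset_def')
  then show ?thesis using a_repr_independence' assms by auto
qed

lemma coset_eqD:
  assumes "coboundaries C i +>\<^bsub>cobj C i\<^esub> u = coboundaries C i +>\<^bsub>cobj C i\<^esub> v" "u \<in> carrier (cobj C i)"
  obtains b where "b \<in> coboundaries C i" "u = b \<oplus>\<^bsub>cobj C i\<^esub> v"
proof -
  interpret abelian_subgroup "coboundaries C i" "cobj C i" by (rule abelian_subgroup_coboundaries)
  have "u \<in> coboundaries C i +>\<^bsub>cobj C i\<^esub> v"
    using a_rcos_self[OF assms(2)] assms(1) by simp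
  then show thesis using that by (auto simp: a_r_coset_def')
qed

end

context
  fixes K :: "'k ring" and C :: "('k, 'v) cochain" and D :: "('k, 'w) cochain" and f
  assumes C: "cochain_complex K C" and D: "cochain_complex K D" and f: "cochain_map K C D f"
begin

lemma cochain_map_hom: "abelian_group_hom (cobj C i) (cobj D i) (f i)"
  using f by (intro lin_hom_abelian_group_hom[where K = K] abelian_group_cobj[OF C] abelian_group_cobj[OF D])
    (auto simp: cochain_map_def)

lemma cochain_map_cdiff: "v \<in> carrier (cobj C i) \<Longrightarrow> f (i + 1) (cdiff C i v) = cdiff D i (f i v)"
  using f by (simp add: cochain_map_def)

lemma cochain_map_cocycles: "v \<in> cocycles C i \<Longrightarrow> f i v \<in> cocycles D i"
  using abelian_group_hom.hom_closed[OF cochain_map_hom] cochain_map_cdiff[of v i]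
    abelian_group_hom.hom_zero[OF cochain_map_hom] by (auto simp: cocycles_def)

lemma cochain_map_coboundaries: "v \<in> coboundaries C i \<Longrightarrow> f i v \<in> coboundaries D i"
  using abelian_group_hom.hom_closed[OF cochain_map_hom] cochain_map_cdiff[of _ "i - 1"]
  by (fastforce simp: coboundaries_def)

text \<open>As \<open>f\<close> sends coboundaries to coboundaries, each \<open>f i b\<close>
  arising from the source coset is absorbed into the coboundaries of \<open>D\<close>.\<close>

lemma cohomology_map_coset:
  assumes "v \<in> cocycles C i"
  shows "cohomology_map D f i (coboundaries C i +>\<^bsub>cobj C i\<^esub> v) = coboundaries D i +>\<^bsub>cobj D i\<^esub> f i v"
proof -
  interpret h: abelian_group_hom "cobj C i" "cobj D i" "f i" by (rule cochain_map_hom)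
  interpret S: abelian_subgroup "coboundaries C i" "cobj C i" by (rule abelian_subgroup_coboundaries[OF C])
  interpret T: abelian_subgroup "coboundaries D i" "cobj D i" by (rule abelian_subgroup_coboundaries[OF D])
  have v: "v \<in> carrier (cobj C i)" using assms by (simp add: cocycles_def)
  have *: "c \<oplus>\<^bsub>cobj D i\<^esub> f i (b \<oplus>\<^bsub>cobj C i\<^esub> v) = (c \<oplus>\<^bsub>cobj D i\<^esub> f i b) \<oplus>\<^bsub>cobj D i\<^esub> f i v"
    if "c \<in> coboundaries D i" "b \<in> coboundaries C i" for b c
    using that v by (simp add: h.H.a_assoc)
  have "cohomology_map D f i (coboundaries C i +>\<^bsub>cobj C i\<^esub> v)
    = (\<Union>c\<in>coboundaries D i. \<Union>b\<in>coboundaries C i. {c \<oplus>\<^bsub>cobj D i\<^esub> f i (b \<oplus>\<^bsub>cobj C i\<^esub> v)})"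
    by (auto simp: cohomology_map_def set_add_def' a_r_coset_def')
  also have "\<dots> = (\<Union>c\<in>coboundaries D i. \<Union>b\<in>coboundaries C i. {(c \<oplus>\<^bsub>cobj D i\<^esub> f i b) \<oplus>\<^bsub>cobj D i\<^esub> f i v})"
    using * by simp
  also have "\<dots> = (\<Union>c\<in>coboundaries D i. {c \<oplus>\<^bsub>cobj D i\<^esub> f i v})" (is "?A = ?B")
  proof
    show "?A \<subseteq> ?B" using cochain_map_coboundaries by blast
    show "?B \<subseteq> ?A"
    proof
      fix x assume "x \<in> ?B"
      then obtain c where c: "c \<in> coboundaries D i" "x = c \<oplus>\<^bsub>cobj D i\<^esub> f i v" by blast
      \<comment> \<open>The zero coboundary of \<open>C\<close> serves as \<open>b\<close> here, so
        no element of the coset of \<open>f i v\<close> is lost.\<close>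
      then have "x = (c \<oplus>\<^bsub>cobj D i\<^esub> f i \<zero>\<^bsub>cobj C i\<^esub>) \<oplus>\<^bsub>cobj D i\<^esub> f i v" by simp
      then show "x \<in> ?A" using c(1) S.zero_closed by blast
    qed
  qed
  finally show ?thesis by (simp add: a_r_coset_def')
qed

end

text \<open>On a cocycle the summand \<open>h (d v)\<close> of the homotopy formula vanishes, and
  only the coboundary \<open>d (h v)\<close> remains.\<close>

lemma homotopic_id_cocycle:
  assumes C: "cochain_complex K C" and k: "homotopic_maps K C C k (\<lambda>i v. v)" and v: "v \<in> cocycles C i"
  shows "\<exists>b\<in>coboundaries C i. k i v = v \<oplus>\<^bsub>cobj C i\<^esub> b"
proof -
  obtain h where h: "h j \<in> lin_hom K (cobj C j) (cobj C (j - 1))"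
    and eq: "v \<in> carrier (cobj C j) \<Longrightarrow> k j v = v \<oplus>\<^bsub>cobj C j\<^esub>
             (cdiff C (j - 1) (h j v) \<oplus>\<^bsub>cobj C j\<^esub> h (j + 1) (cdiff C j v))" for j v
    using k unfolding homotopic_maps_def by blast
  have hom: "abelian_group_hom (cobj C j) (cobj C (j - 1)) (h j)" for j
    by (rule lin_hom_abelian_group_hom[OF h abelian_group_cobj[OF C] abelian_group_cobj[OF C]])
  interpret d: abelian_group_hom "cobj C (i - 1)" "cobj C i" "cdiff C (i - 1)" by (rule cdiff_hom'[OF C])
  have "h (i + 1) \<zero>\<^bsub>cobj C (i + 1)\<^esub> = \<zero>\<^bsub>cobj C i\<^esub>"
    using abelian_group_hom.hom_zero[OF hom, of "i + 1"] by simp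
  moreover have "v \<in> carrier (cobj C i)" "h i v \<in> carrier (cobj C (i - 1))"
    using v abelian_group_hom.hom_closed[OF hom] by (auto simp: cocycles_def)
  ultimately show ?thesis
    using eq[of v i] v by (auto simp: cocycles_def coboundaries_def)
qed

text \<open>By \<open>homotopic_id_cocycle\<close> both composites fix every cohomology class. For
  \<open>g f\<close> this yields injectivity; for \<open>f g\<close> it shows that the class of
  \<open>g v\<close> is a preimage of the class of \<open>v\<close>.\<close>

lemma homotopy_equivalence_quasi_isomorphism:
  fixes C :: "('k, 'v) cochain" and D :: "('k, 'w) cochain"
  assumes C: "cochain_complex K C" and D: "cochain_complex K D"
    and f: "cochain_map K C D f" and g: "cochain_map K D C g"
    and gf: "homotopic_maps K C C (\<lambda>i v. g i (f i v)) (\<lambda>i v. v)"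
    and fg: "homotopic_maps K D D (\<lambda>i v. f i (g i v)) (\<lambda>i v. v)"
  shows "quasi_isomorphism K C D f"
  unfolding quasi_isomorphism_def
proof (intro conjI allI f)
  fix i
  interpret f: abelian_group_hom "cobj C i" "cobj D i" "f i" by (rule cochain_map_hom[OF C D f])
  interpret g: abelian_group_hom "cobj D i" "cobj C i" "g i" by (rule cochain_map_hom[OF D C g])
  interpret S: abelian_subgroup "coboundaries C i" "cobj C i" by (rule abelian_subgroup_coboundaries[OF C])
  interpret T: abelian_subgroup "coboundaries D i" "cobj D i" by (rule abelian_subgroup_coboundaries[OF D])
  note coset = cohomology_map_coset[OF C D f] and coc = cochain_map_cocycles[OF C D f]
    and coc' = cochain_map_cocycles[OF D C g]
  let ?B = "\<lambda>v. coboundaries C i +>\<^bsub>cobj C i\<^esub> v" and ?B' = "\<lambda>v. coboundaries D i +>\<^bsub>cobj D i\<^esub> v"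
  have gf_eq: "?B (g i (f i v)) = ?B v" if v: "v \<in> cocycles C i" for v
  proof -
    obtain b where "b \<in> coboundaries C i" "g i (f i v) = v \<oplus>\<^bsub>cobj C i\<^esub> b"
      using homotopic_id_cocycle[OF C gf v] by blast
    then show ?thesis
      using coset_eqI[OF C, of b i v] cocycles_carrier[OF v] by (simp add: f.G.a_comm[of v])
  qed
  have fg_eq: "?B' (f i (g i v)) = ?B' v" if v: "v \<in> cocycles D i" for v
  proof -
    obtain b where "b \<in> coboundaries D i" "f i (g i v) = v \<oplus>\<^bsub>cobj D i\<^esub> b"
      using homotopic_id_cocycle[OF D fg v] by blast
    then show ?thesis
      using coset_eqI[OF D, of b i v] cocycles_carrier[OF v] by (simp add: f.H.a_comm[of v])
  qed
  show "cohomology_map D f i \<in> iso (cohomology C i) (cohomology D i)"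
    unfolding iso_def hom_def bij_betw_def
  proof (intro CollectI conjI funcsetI ballI)
    show "cohomology_map D f i c \<in> carrier (cohomology D i)" if "c \<in> carrier (cohomology C i)" for c
      using that coset coc by (auto simp: carrier_cohomology)
  next
    fix c c' assume "c \<in> carrier (cohomology C i)" "c' \<in> carrier (cohomology C i)"
    then obtain u v where "c = ?B u" "c' = ?B v" "u \<in> cocycles C i" "v \<in> cocycles C i"
      by (auto simp: carrier_cohomology)
    then show "cohomology_map D f i (c \<otimes>\<^bsub>cohomology C i\<^esub> c')
        = cohomology_map D f i c \<otimes>\<^bsub>cohomology D i\<^esub> cohomology_map D f i c'"
      by (simp add: mult_cohomology coset_add[OF C] coset_add[OF D] coset coc cocycles_add[OF C] cocycles_carrier)
  next
    show "inj_on (cohomology_map D f i) (carrier (cohomology C i))"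
    proof (rule inj_onI)
      fix c c' assume "c \<in> carrier (cohomology C i)" "c' \<in> carrier (cohomology C i)"
        and eq: "cohomology_map D f i c = cohomology_map D f i c'"
      then obtain u v where uv: "c = ?B u" "c' = ?B v" "u \<in> cocycles C i" "v \<in> cocycles C i"
        by (auto simp: carrier_cohomology)
      then obtain b where b: "b \<in> coboundaries D i" "f i u = b \<oplus>\<^bsub>cobj D i\<^esub> f i v"
        using coset_eqD[OF D, of i "f i u" "f i v" thesis] eq uv by (simp add: coset coc cocycles_carrier)
      \<comment> \<open>Applying \<open>g\<close> to \<open>f i u = b + f i v\<close> turns
        \<open>b\<close> into a coboundary of \<open>C\<close>.\<close>
      have "?B (g i (f i u)) = ?B (g i (f i v))"
        using b uv coset_eqI[OF C cochain_map_coboundaries[OF D C g b(1)], of "g i (f i v)"]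
        by (simp add: cocycles_carrier)
      then show "c = c'" using uv gf_eq by simp
    qed
  next
    have "\<exists>c\<in>carrier (cohomology C i). cohomology_map D f i c = ?B' v" if v: "v \<in> cocycles D i" for v
      using fg_eq[OF that] coset[OF coc'[OF that]] coc'[OF that] by (auto simp: carrier_cohomology)
    then show "cohomology_map D f i ` carrier (cohomology C i) = carrier (cohomology D i)"
      using coset coc by (fastforce simp: carrier_cohomology)
  qed
qed

section \<open>Evaluation and divided differences\<close>

text \<open>The target is kept abstract so that the polynomial identities can be proved for
  arbitrary ring elements; the instance used later is \<open>cst\<close>, with target
  \<open>k[w][z]\<close>.\<close>

locale scalar_hom =
  fixes \<iota> :: "'k :: field \<Rightarrow> 'c :: idom"
  assumes hom_zero [simp]: "\<iota> 0 = 0"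
    and hom_one [simp]: "\<iota> 1 = 1"
    and hom_add: "\<iota> (a + b) = \<iota> a + \<iota> b"
    and hom_mult: "\<iota> (a * b) = \<iota> a * \<iota> b"
begin

definition evl :: "'k poly \<Rightarrow> 'c \<Rightarrow> 'c" where
  "evl \<phi> y = (\<Sum>i\<le>Polynomial.degree \<phi>. \<iota> (poly.coeff \<phi> i) * y ^ i)"

definition ddiff :: "'k poly \<Rightarrow> 'c \<Rightarrow> 'c \<Rightarrow> 'c" where
  "ddiff \<phi> x y = (\<Sum>i\<le>Polynomial.degree \<phi>. \<Sum>j=1..i. \<iota> (poly.coeff \<phi> i) * (x ^ (i - j) * y ^ (j - 1)))"

text \<open>The partial derivative of \<open>ddiff\<close> in its second argument. At
  \<open>j = 1\<close> the truncated exponent \<open>j - 2\<close> is harmless because the factor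
  \<open>of_nat (j - 1)\<close> is zero.\<close>

definition ddiff' :: "'k poly \<Rightarrow> 'c \<Rightarrow> 'c \<Rightarrow> 'c" where
  "ddiff' \<phi> x y = (\<Sum>i\<le>Polynomial.degree \<phi>. \<Sum>j=1..i.
     \<iota> (poly.coeff \<phi> i) * (x ^ (i - j) * (of_nat (j - 1) * y ^ (j - 2))))"

text \<open>A nonzero scalar is invertible, so its image is nonzero. Hence
  \<open>map_poly \<iota>\<close> preserves degrees, which is what \<open>evl_poly\<close>
  needs.\<close>

lemma hom_eq_zero_iff [simp]: "\<iota> a = 0 \<longleftrightarrow> a = 0"
proof
  assume "\<iota> a = 0"
  then have "\<iota> (a * inverse a) = 0" by (simp add: hom_mult)
  then show "a = 0" by (cases "a = 0") simp_all
qed simp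

lemma evl_poly: "evl \<phi> y = poly (map_poly \<iota> \<phi>) y"
  by (simp add: evl_def poly_altdef degree_map_poly coeff_map_poly)

lemma hom_sum: "\<iota> (sum f I) = (\<Sum>i\<in>I. \<iota> (f i))"
  by (induction I rule: infinite_finite_induct) (auto simp: hom_add)

lemma evl_add: "evl (\<phi> + \<psi>) y = evl \<phi> y + evl \<psi> y"
proof -
  have "map_poly \<iota> (\<phi> + \<psi>) = map_poly \<iota> \<phi> + map_poly \<iota> \<psi>"
    by (intro poly_eqI) (simp add: coeff_map_poly hom_add)
  then show ?thesis by (simp add: evl_poly)
qed

lemma evl_mult: "evl (\<phi> * \<psi>) y = evl \<phi> y * evl \<psi> y"
proof -
  have "map_poly \<iota> (\<phi> * \<psi>) = map_poly \<iota> \<phi> * map_poly \<iota> \<psi>"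
    by (intro poly_eqI) (simp add: coeff_map_poly coeff_mult hom_sum hom_mult)
  then show ?thesis by (simp add: evl_poly)
qed

lemma evl_one: "evl 1 y = 1"
  by (simp add: evl_def)

lemma hom_of_nat: "\<iota> (of_nat n) = of_nat n"
  by (induction n) (simp_all add: hom_add)

lemma evl_zero [simp]: "evl 0 y = 0"
  by (simp add: evl_def)

lemma evl_pCons: "evl (pCons c \<phi>) y = \<iota> c + y * evl \<phi> y"
  by (simp add: evl_poly map_poly_pCons)

lemma evl_smult: "evl (Polynomial.smult c \<phi>) y = \<iota> c * evl \<phi> y"
  by (induction \<phi>) (simp_all add: evl_pCons hom_mult algebra_simps)

lemma twist_pCons: "twist q (pCons c \<phi>) = [:c:] + [:0, q:] * twist q \<phi>"
  by (simp add: twist_def pcompose_pCons)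

lemma evl_twist: "evl (twist q \<phi>) y = evl \<phi> (\<iota> q * y)"
  by (induction \<phi>)
    (simp_all add: evl_pCons evl_smult twist_pCons evl_add evl_mult mult_ac, simp add: twist_def)

lemma evl_monom: "evl (Polynomial.monom c n) y = \<iota> c * y ^ n"
  by (induction n) (simp_all add: evl_pCons monom_0 monom_Suc mult_ac)

text \<open>The derivative is written as a sum over the coefficients of \<open>\<phi>\<close>
  itself, with the same range as \<open>ddiff'\<close>, so that both can be compared term by
  term.\<close>

lemma evl_pderiv:
  "evl (pderiv \<phi>) y = (\<Sum>i\<le>Polynomial.degree \<phi>. \<iota> (poly.coeff \<phi> i) * (of_nat i * y ^ (i - 1)))"
proof -
  have "poly (map_poly \<iota> (pderiv \<phi>)) y = poly (pderiv (map_poly \<iota> \<phi>)) y"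
    by (intro arg_cong2[of _ _ _ _ poly] poly_eqI refl)
      (simp add: coeff_map_poly coeff_pderiv hom_mult hom_of_nat hom_add)
  also have "map_poly \<iota> \<phi> = (\<Sum>i\<le>Polynomial.degree \<phi>. Polynomial.monom (\<iota> (poly.coeff \<phi> i)) i)"
    by (intro poly_eqI) (auto simp: coeff_map_poly coeff_sum coeff_eq_0 if_distrib sum.delta cong: if_cong)
  finally show ?thesis
    by (simp add: evl_poly higher_pderiv_sum[of 1, simplified] pderiv_monom poly_sum poly_monom algebra_simps)
qed

text \<open>Geometric sum: in the induction the summand \<open>j = Suc i\<close> is split off, and
  all the others gain a factor \<open>x\<close>.\<close>

lemma ddiff_monom:
  fixes x y :: 'c
  shows "(x - y) * (\<Sum>j=1..i. x ^ (i - j) * y ^ (j - 1)) = x ^ i - y ^ i"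
proof (induction i)
  case (Suc i)
  have "(\<Sum>j=1..Suc i. x ^ (Suc i - j) * y ^ (j - 1)) = x * (\<Sum>j=1..i. x ^ (i - j) * y ^ (j - 1)) + y ^ i"
    by (simp add: sum_distrib_left Suc_diff_le mult.assoc)
  then have "(x - y) * (\<Sum>j=1..Suc i. x ^ (Suc i - j) * y ^ (j - 1)) = x * (x ^ i - y ^ i) + (x - y) * y ^ i"
    by (simp only: Suc.IH[symmetric]) (simp add: algebra_simps)
  then show ?case by (simp add: algebra_simps)
qed simp

text \<open>Formally the derivative in \<open>y\<close> of \<open>ddiff_monom\<close>. As
  \<open>x\<close> and \<open>y\<close> are ring elements and not variables, it is proved by a
  separate induction.\<close>

lemma ddiff'_monom:
  fixes x y :: 'c
  shows "(x - y) * (\<Sum>j=1..i. x ^ (i - j) * (of_nat (j - 1) * y ^ (j - 2)))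
    = (\<Sum>j=1..i. x ^ (i - j) * y ^ (j - 1)) - of_nat i * y ^ (i - 1)"
proof (induction i)
  case (Suc i)
  let ?S = "\<lambda>i. \<Sum>j=1..i. x ^ (i - j) * (of_nat (j - 1) * y ^ (j - 2))"
  let ?T = "\<lambda>i. \<Sum>j=1..i. x ^ (i - j) * y ^ (j - 1)"
  have S: "?S (Suc i) = x * ?S i + of_nat i * y ^ (i - 1)"
    by (simp add: sum_distrib_left Suc_diff_le mult.assoc)
  have T: "?T (Suc i) = x * ?T i + y ^ i"
    by (simp add: sum_distrib_left Suc_diff_le mult.assoc)
  \<comment> \<open>At \<open>i = 0\<close> the exponent \<open>i - 1\<close> is truncated, but then
    \<open>of_nat i\<close> is zero.\<close>
  have y: "of_nat i * (y * y ^ (i - 1)) = of_nat i * y ^ i"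
    by (cases i) simp_all
  have "(x - y) * ?S (Suc i) = x * ((x - y) * ?S i) + (x - y) * (of_nat i * y ^ (i - 1))"
    by (simp only: S) (simp add: algebra_simps)
  also have "\<dots> = x * ?T i - of_nat i * (y * y ^ (i - 1))"
    by (simp only: Suc.IH) (simp add: algebra_simps)
  finally show ?case by (simp only: T y) (simp add: algebra_simps)
qed simp

lemma ddiff_eq: "(x - y) * ddiff \<phi> x y = evl \<phi> x - evl \<phi> y"
  by (simp add: ddiff_def evl_def sum_distrib_left[symmetric] sum_subtractf[symmetric]
      right_diff_distrib[symmetric] ddiff_monom[symmetric])
    (simp add: sum_distrib_left mult_ac)

lemma ddiff'_eq: "(x - y) * ddiff' \<phi> x y = ddiff \<phi> x y - evl (pderiv \<phi>) y"
proof -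
  have "(x - y) * ddiff' \<phi> x y = (\<Sum>i\<le>Polynomial.degree \<phi>. \<iota> (poly.coeff \<phi> i) *
      ((x - y) * (\<Sum>j=1..i. x ^ (i - j) * (of_nat (j - 1) * y ^ (j - 2)))))"
    by (simp add: ddiff'_def sum_distrib_left mult_ac)
  then show ?thesis
    by (simp only: ddiff'_monom)
      (simp add: ddiff_def evl_pderiv right_diff_distrib sum_subtractf sum_distrib_left)
qed

end

section \<open>Operators with the relations of a generalized Weyl algebra\<close>

text \<open>\<open>z\<close> and \<open>w\<close> model left and right multiplication by the
  generator \<open>z\<close>; the operators model those by \<open>x\<close> and \<open>y\<close>.
  Right multiplications compose in reverse order: \<open>Rx (Ry m)\<close> is \<open>m y x\<close>,
  hence \<open>p\<close> occurs there at the untwisted \<open>w\<close>.\<close>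

locale gwa_operators = scalar_hom \<iota> + Modules.module scale
  for \<iota> :: "'k :: field \<Rightarrow> 'c :: idom" and scale :: "'c \<Rightarrow> 'm :: ab_group_add \<Rightarrow> 'm" (infixr "*s" 75) +
  fixes q :: 'k and p \<alpha> \<beta> :: "'k poly" and z w :: 'c and Lx Ly Rx Ry :: "'m \<Rightarrow> 'm"
  assumes q_nonzero: "q \<noteq> 0"
    and bezout: "\<alpha> * p + \<beta> * pderiv p = 1"
    and Lx_add: "Lx (m + n) = Lx m + Lx n"
    and Ly_add: "Ly (m + n) = Ly m + Ly n"
    and Rx_add: "Rx (m + n) = Rx m + Rx n"
    and Ry_add: "Ry (m + n) = Ry m + Ry n"
    and Lx_hom: "Lx (\<iota> c *s m) = \<iota> c *s Lx m"
    and Ly_hom: "Ly (\<iota> c *s m) = \<iota> c *s Ly m"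
    and Rx_hom: "Rx (\<iota> c *s m) = \<iota> c *s Rx m"
    and Ry_hom: "Ry (\<iota> c *s m) = \<iota> c *s Ry m"
    and Lx_z: "Lx (z *s m) = (\<iota> q * z) *s Lx m"
    and Lx_w: "Lx (w *s m) = w *s Lx m"
    and Ly_qz: "Ly ((\<iota> q * z) *s m) = z *s Ly m"
    and Ly_w: "Ly (w *s m) = w *s Ly m"
    and Rx_z: "Rx (z *s m) = z *s Rx m"
    and Rx_qw: "Rx ((\<iota> q * w) *s m) = w *s Rx m"
    and Ry_z: "Ry (z *s m) = z *s Ry m"
    and Ry_w: "Ry (w *s m) = (\<iota> q * w) *s Ry m"
    and LyLx: "Ly (Lx m) = evl p z *s m"
    and LxLy: "Lx (Ly m) = evl p (\<iota> q * z) *s m"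
    and RxRy: "Rx (Ry m) = evl p w *s m"
    and RyRx: "Ry (Rx m) = evl p (\<iota> q * w) *s m"
    and RxLx: "Rx (Lx m) = Lx (Rx m)"
    and RxLy: "Rx (Ly m) = Ly (Rx m)"
    and RyLx: "Ry (Lx m) = Lx (Ry m)"
    and RyLy: "Ry (Ly m) = Ly (Ry m)"
begin

text \<open>In the notation of the statement, \<open>bdiff z w\<close> is the action of \<open>p\<^sub>1 \<otimes> \<beta> p\<^sub>2'\<close>.\<close>

definition bdiff where "bdiff x y = evl \<beta> y * ddiff' p x y"

text \<open>For additive \<open>S\<close> the pairs \<open>(x, x')\<close> are closed under sums and
  products, so commutation rules for \<open>z\<close> and \<open>w\<close> extend to all polynomial
  expressions in them.\<close>

definition twists :: "('m \<Rightarrow> 'm) \<Rightarrow> 'c \<Rightarrow> 'c \<Rightarrow> bool" where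
  "twists S x x' \<longleftrightarrow> (\<forall>m. S (x *s m) = x' *s S m)"

lemma twists_mult: "twists S x x' \<Longrightarrow> twists S y y' \<Longrightarrow> twists S (x * y) (x' * y')"
  by (simp add: twists_def flip: scale_scale)

lemma twists_one: "twists S 1 1"
  by (simp add: twists_def)

lemma twists_power: "twists S x x' \<Longrightarrow> twists S (x ^ n) (x' ^ n)"
  by (induction n) (simp_all add: twists_mult twists_one)

lemma additive_zero: "(\<And>m n. S (m + n) = S m + S n) \<Longrightarrow> S (0 :: 'm) = (0 :: 'm)"
  by (metis add_cancel_right_left)

lemma twists_add:
  "(\<And>m n. S (m + n) = S m + S n) \<Longrightarrow> twists S x x' \<Longrightarrow> twists S y y' \<Longrightarrow> twists S (x + y) (x' + y')"
  by (simp add: twists_def scale_left_distrib)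

lemma twists_sum:
  assumes "\<And>m n. S (m + n) = S m + S n" "\<And>i. i \<in> I \<Longrightarrow> twists S (f i) (g i)"
  shows "twists S (sum f I) (sum g I)"
  using assms(2)
proof (induction I rule: infinite_finite_induct)
  case (insert i I)
  then show ?case by (simp add: twists_add[OF assms(1)])
qed (simp_all add: twists_def additive_zero[OF assms(1)])

lemma twists_of_nat: "(\<And>m n. S (m + n) = S m + S n) \<Longrightarrow> twists S (of_nat n) (of_nat n)"
  by (induction n) (auto simp: twists_def additive_zero intro!: twists_add[unfolded twists_def, rule_format])

lemma hom_q_inverse [simp]:
  "\<iota> q *s \<iota> (inverse q) *s m = m" "\<iota> (inverse q) *s \<iota> q *s m = m"
  using q_nonzero by (simp_all flip: hom_mult)

lemma twists_rules:
  assumes "\<And>m n. S (m + n) = S m + S n" and "\<And>c m. S (\<iota> c *s m) = \<iota> c *s S m"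
  shows "twists S y y' \<Longrightarrow> S (evl \<phi> y *s m) = evl \<phi> y' *s S m"
    and "twists S x x' \<Longrightarrow> twists S y y' \<Longrightarrow> S (ddiff p x y *s m) = ddiff p x' y' *s S m"
    and "twists S x x' \<Longrightarrow> twists S y y' \<Longrightarrow> S (bdiff x y *s m) = bdiff x' y' *s S m"
proof -
  have i: "twists S (\<iota> c) (\<iota> c)" for c using assms(2) by (simp add: twists_def)
  note r = twists_sum[OF assms(1)] twists_mult twists_power i twists_of_nat[OF assms(1)]
  have e: "twists S (evl \<phi> y) (evl \<phi> y')" if "twists S y y'" for \<phi> y y'
    unfolding evl_def by (intro r that)
  show "twists S y y' \<Longrightarrow> S (evl \<phi> y *s m) = evl \<phi> y' *s S m"
    using e by (simp add: twists_def)
  show "S (ddiff p x y *s m) = ddiff p x' y' *s S m" if "twists S x x'" "twists S y y'"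
    using twists_def[of S "ddiff p x y" "ddiff p x' y'"] that unfolding ddiff_def by (auto intro!: r)
  have "twists S (bdiff x y) (bdiff x' y')" if "twists S x x'" "twists S y y'"
    unfolding bdiff_def ddiff'_def by (intro r e that)
  then show "S (bdiff x y *s m) = bdiff x' y' *s S m" if "twists S x x'" "twists S y y'"
    using that by (simp add: twists_def)
qed

section \<open>Commutation and reduction rules for the normal form\<close>

abbreviation "zt \<equiv> \<iota> q * z"
abbreviation "wt \<equiv> \<iota> q * w"

text \<open>These are pairs whose members stay among \<open>z\<close>, \<open>zt\<close>,
  \<open>w\<close> and \<open>wt\<close>, the arguments at which \<open>evl\<close>,
  \<open>ddiff\<close> and \<open>bdiff\<close> occur in the matrices.\<close>

lemma twists_gen:
  "twists Lx z zt" "twists Lx w w" "twists Lx wt wt" "twists Ly zt z" "twists Ly w w" "twists Ly wt wt"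
  "twists Rx z z" "twists Rx zt zt" "twists Rx wt w" "twists Ry z z" "twists Ry zt zt" "twists Ry w wt"
  using Lx_z Lx_w Ly_qz Ly_w Rx_z Rx_qw Ry_z Ry_w
  by (auto simp: twists_def Lx_hom Ly_hom Rx_hom Ry_hom simp flip: scale_scale)

lemmas Lx_rules = twists_rules[of Lx, OF Lx_add Lx_hom]
lemmas Ly_rules = twists_rules[of Ly, OF Ly_add Ly_hom]
lemmas Rx_rules = twists_rules[of Rx, OF Rx_add Rx_hom]
lemmas Ry_rules = twists_rules[of Ry, OF Ry_add Ry_hom]

text \<open>The axiom moves \<open>zt\<close> past \<open>Ly\<close>; dividing by \<open>q\<close>
  gives a rule for \<open>z\<close> alone, since normal forms split \<open>zt\<close> into
  \<open>\<iota> q\<close> and \<open>z\<close>.\<close>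

lemma Ly_z: "Ly (z *s m) = \<iota> (inverse q) *s z *s Ly m"
  using Ly_qz[of "\<iota> (inverse q) *s m"] by (simp add: scale_left_commute Ly_hom flip: scale_scale)

lemma Rx_w: "Rx (w *s m) = \<iota> (inverse q) *s w *s Rx m"
  using Rx_qw[of "\<iota> (inverse q) *s m"] by (simp add: scale_left_commute Rx_hom flip: scale_scale)

lemma bezout_evl: "evl \<beta> y * evl (pderiv p) y = 1 - evl \<alpha> y * evl p y"
  using arg_cong[OF bezout, of "\<lambda>\<phi>. evl \<phi> y"] by (simp add: evl_add evl_mult evl_one algebra_simps)

text \<open>Multiply \<open>ddiff'_eq\<close> by \<open>evl \<beta> y\<close> and replace \<beta> p'
  by 1 - \<alpha> p. This carries the Bezout relation into the homotopy identities, at twisted and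
  untwisted arguments alike.\<close>

lemma bdiff_eq: "(x - y) * bdiff x y = evl \<beta> y * ddiff p x y - 1 + evl \<alpha> y * evl p y"
proof -
  have "(x - y) * bdiff x y = evl \<beta> y * ((x - y) * ddiff' p x y)" by (simp add: bdiff_def)
  also have "\<dots> = evl \<beta> y * ddiff p x y - evl \<beta> y * evl (pderiv p) y"
    by (simp only: ddiff'_eq right_diff_distrib)
  finally show ?thesis by (simp add: bezout_evl)
qed

text \<open>Solved for \<open>x\<close> times the divided difference, so that as a rewrite rule it
  trades the first variable for the second.\<close>

lemma scale_ddiff: "x *s ddiff p x y *s m = y *s ddiff p x y *s m + evl p x *s m - evl p y *s m"
  using arg_cong[OF ddiff_eq[of x y p], of "\<lambda>c. c *s m"]
  by (simp add: scale_left_diff_distrib algebra_simps)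

lemma scale_bdiff: "x *s bdiff x y *s m = y *s bdiff x y *s m + evl \<beta> y *s ddiff p x y *s m - m + evl \<alpha> y *s evl p y *s m"
  using arg_cong[OF bdiff_eq[of x y], of "\<lambda>c. c *s m"]
  by (simp add: scale_left_diff_distrib scale_left_distrib algebra_simps)

text \<open>With a twisted first argument the reduction rules start with \<open>zt\<close>; division
  by \<open>q\<close> puts \<open>z\<close> in front, as the normal form requires.\<close>

lemma zt_eqD:
  assumes "zt *s a = b" shows "z *s a = \<iota> (inverse q) *s b"
  using assms[symmetric] by (simp only: hom_q_inverse flip: scale_scale)

lemma z_rules:
  "z *s ddiff p z w *s m = w *s ddiff p z w *s m + evl p z *s m - evl p w *s m"
  "z *s ddiff p z wt *s m = \<iota> q *s w *s ddiff p z wt *s m + evl p z *s m - evl p wt *s m"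
  "z *s ddiff p zt w *s m = \<iota> (inverse q) *s (w *s ddiff p zt w *s m + evl p zt *s m - evl p w *s m)"
  "z *s ddiff p zt wt *s m = w *s ddiff p zt wt *s m + \<iota> (inverse q) *s (evl p zt *s m - evl p wt *s m)"
  "z *s bdiff z w *s m = w *s bdiff z w *s m + evl \<beta> w *s ddiff p z w *s m - m + evl \<alpha> w *s evl p w *s m"
  "z *s bdiff z wt *s m = \<iota> q *s w *s bdiff z wt *s m + evl \<beta> wt *s ddiff p z wt *s m - m + evl \<alpha> wt *s evl p wt *s m"
  "z *s bdiff zt w *s m = \<iota> (inverse q) *s
     (w *s bdiff zt w *s m + evl \<beta> w *s ddiff p zt w *s m - m + evl \<alpha> w *s evl p w *s m)"
  "z *s bdiff zt wt *s m = w *s bdiff zt wt *s m + \<iota> (inverse q) *s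
     (evl \<beta> wt *s ddiff p zt wt *s m - m + evl \<alpha> wt *s evl p wt *s m)"
  using scale_ddiff[of z w m] scale_ddiff[of z wt m] zt_eqD[OF scale_ddiff[of zt w m]]
    zt_eqD[OF scale_ddiff[of zt wt m]]
    scale_bdiff[of z w m] scale_bdiff[of z wt m] zt_eqD[OF scale_bdiff[of zt w m]] zt_eqD[OF scale_bdiff[of zt wt m]]
  by (simp_all add: scale_right_distrib scale_right_diff_distrib flip: scale_scale)

lemmas z_rules' = z_rules[THEN arg_cong[where f = "\<lambda>m. r *s m" for r], THEN trans[OF scale_left_commute]]

lemmas additive_rules [simp] =
  Lx_add Ly_add Rx_add Ry_add
  additive_zero[OF Lx_add] additive_zero[OF Ly_add] additive_zero[OF Rx_add] additive_zero[OF Ry_add]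

lemma minus_rules [simp]:
  "Lx (- m) = - Lx m" "Ly (- m) = - Ly m" "Rx (- m) = - Rx m" "Ry (- m) = - Ry m"
  "Lx (m - n) = Lx m - Lx n" "Ly (m - n) = Ly m - Ly n" "Rx (m - n) = Rx m - Rx n" "Ry (m - n) = Ry m - Ry n"
proof -
  have *: "S (- m) = - S m" if "\<And>m n. S (m + n) = S m + S n" for S :: "'m \<Rightarrow> 'm" and m
    using that[of m "- m"] additive_zero[OF that] by (simp add: eq_neg_iff_add_eq_0 add.commute)
  show neg: "Lx (- m) = - Lx m" "Ly (- m) = - Ly m" "Rx (- m) = - Rx m" "Ry (- m) = - Ry m" for m
    by (rule *, simp)+
  show "Lx (m - n) = Lx m - Lx n" "Ly (m - n) = Ly m - Ly n" "Rx (m - n) = Rx m - Rx n" "Ry (m - n) = Ry m - Ry n"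
    using Lx_add[of m "- n"] Ly_add[of m "- n"] Rx_add[of m "- n"] Ry_add[of m "- n"] by (simp_all add: neg)
qed

text \<open>The converse of \<open>scale_scale\<close>: products of coefficients are split into
  successive actions, which \<open>scale_left_commute\<close> can then sort.\<close>

lemma mult_scale: "(a * b) *s m = a *s b *s m"
  by simp

lemma Lx_z_Ry_w:
  "Lx (z *s m) = \<iota> q *s z *s Lx m"
  "Ry (w *s m) = \<iota> q *s w *s Ry m"
  by (simp_all add: Lx_z Ry_w)

declare scale_scale [simp del]

text \<open>Normal form: polynomials in \<open>z\<close> and \<open>w\<close>, then \<open>Lx\<close> or \<open>Ly\<close>, then \<open>Rx\<close> or
  \<open>Ry\<close>, where \<open>z\<close> never multiplies a divided difference. For the latter \<open>z_rules'\<close> is needed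
  because ordered rewriting may leave one other factor in between.\<close>

lemmas norm_rules =
  Lx_hom Ly_hom Rx_hom Ry_hom Lx_z_Ry_w Lx_w Ly_z Ly_w Rx_z Rx_w Ry_z
  Lx_rules[OF twists_gen(1)] Lx_rules[OF twists_gen(2)] Lx_rules[OF twists_gen(3)]
  Lx_rules(2,3)[OF twists_gen(1) twists_gen(2)] Lx_rules(2,3)[OF twists_gen(1) twists_gen(3)]
  Ly_rules[OF twists_gen(4)] Ly_rules[OF twists_gen(5)] Ly_rules[OF twists_gen(6)]
  Ly_rules(2,3)[OF twists_gen(4) twists_gen(5)] Ly_rules(2,3)[OF twists_gen(4) twists_gen(6)]
  Rx_rules[OF twists_gen(7)] Rx_rules[OF twists_gen(8)] Rx_rules[OF twists_gen(9)]
  Rx_rules(2,3)[OF twists_gen(7) twists_gen(9)] Rx_rules(2,3)[OF twists_gen(8) twists_gen(9)]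
  Ry_rules[OF twists_gen(10)] Ry_rules[OF twists_gen(11)] Ry_rules[OF twists_gen(12)]
  Ry_rules(2,3)[OF twists_gen(10) twists_gen(12)] Ry_rules(2,3)[OF twists_gen(11) twists_gen(12)]
  LyLx LxLy RxRy RyRx RxLx RxLy RyLx RyLy
  scale_left_distrib scale_right_distrib scale_left_diff_distrib scale_right_diff_distrib
  scale_minus_left scale_minus_right mult_scale scale_left_commute z_rules z_rules'

text \<open>Subtracted terms are moved across the equation, so that both sides become sums and can
  be compared up to associativity and commutativity.\<close>

lemmas sum_rules = add_diff_eq diff_add_eq diff_diff_eq diff_diff_eq2 diff_eq_eq eq_diff_eq add_ac

text \<open>Componentwise forms of the matrices of \<open>\<S>\<close> and \<open>\<T>\<close>, of \<open>g\<close>, \<open>f\<close> and of the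
  homotopies. The homotopy of \<open>\<S>\<close> is \<open>s_h1\<close>, \<open>s_h2\<close> in degrees 1, 2 and then alternates
  between \<open>s_h3\<close> and \<open>s_h4\<close>; that of \<open>\<T>\<close> is \<open>t_h0\<close>, \<open>t_h1\<close> in degrees 0, -1 and then
  alternates between \<open>t_h2\<close> and \<open>t_h3\<close>.\<close>

definition s_d0 :: "'m list \<Rightarrow> 'm list" where
  "s_d0 v = [Lx (v!0) - Rx (v!0),
    Ly (v!0) - Ry (v!0),
    z *s v!0 - w *s v!0]"

definition s_d1 :: "'m list \<Rightarrow> 'm list" where
  "s_d1 v = [Ly (v!0) + Rx (v!1) - ddiff p z w *s v!2,
    Ry (v!0) + Lx (v!1) - \<iota> q *s ddiff p zt wt *s v!2,
    zt *s v!0 - w *s v!0 + \<iota> q *s Rx (v!2) - Lx (v!2),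
    z *s v!1 - wt *s v!1 + Ry (v!2) - \<iota> q *s Ly (v!2)]"

definition s_d2 :: "'m list \<Rightarrow> 'm list" where
  "s_d2 v = [Lx (v!0) - Rx (v!1) - ddiff p zt w *s v!2,
    - Ry (v!0) + Ly (v!1) - ddiff p z wt *s v!3,
    z *s v!0 - w *s v!0 - Ly (v!2) - Rx (v!3),
    zt *s v!1 - wt *s v!1 - Ry (v!2) - Lx (v!3)]"

definition s_d3 :: "'m list \<Rightarrow> 'm list" where
  "s_d3 v = [Ly (v!0) + Rx (v!1) - ddiff p z w *s v!2,
    Ry (v!0) + Lx (v!1) - ddiff p zt wt *s v!3,
    zt *s v!0 - w *s v!0 - Lx (v!2) + Rx (v!3),
    z *s v!1 - wt *s v!1 + Ry (v!2) - Ly (v!3)]"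

definition t_d1 :: "'m list \<Rightarrow> 'm list" where
  "t_d1 v = [\<iota> q *s Rx (v!0) - Lx (v!0) + \<iota> (inverse q) *s Ry (v!1) - Ly (v!1) + w *s v!2 - z *s v!2]"

definition t_d2 :: "'m list \<Rightarrow> 'm list" where
  "t_d2 v = [\<iota> (inverse q) *s Ry (v!0) + Ly (v!1) + wt *s v!2 - z *s v!2,
    Lx (v!0) + \<iota> q *s Rx (v!1) + w *s v!3 - zt *s v!3,
    - ddiff p z w *s v!0 - \<iota> q *s ddiff p zt wt *s v!1 + \<iota> q *s Lx (v!2) - \<iota> q *s Rx (v!2) + Ly (v!3) - Ry (v!3)]"

definition t_d3 :: "'m list \<Rightarrow> 'm list" where
  "t_d3 v = [\<iota> q *s Rx (v!0) - Ly (v!1) + w *s v!2 - z *s v!2,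
    - Lx (v!0) + \<iota> (inverse q) *s Ry (v!1) + wt *s v!3 - zt *s v!3,
    - ddiff p z wt *s v!0 - \<iota> (inverse q) *s Ry (v!2) - Ly (v!3),
    - ddiff p zt w *s v!1 - Lx (v!2) - \<iota> q *s Rx (v!3)]"

definition t_d4 :: "'m list \<Rightarrow> 'm list" where
  "t_d4 v = [\<iota> (inverse q) *s Ry (v!0) + Ly (v!1) + wt *s v!2 - z *s v!2,
    Lx (v!0) + \<iota> q *s Rx (v!1) + w *s v!3 - zt *s v!3,
    - ddiff p z w *s v!0 - \<iota> q *s Rx (v!2) + Ly (v!3),
    - ddiff p zt wt *s v!1 + Lx (v!2) - \<iota> (inverse q) *s Ry (v!3)]"

definition g_0 :: "'m list \<Rightarrow> 'm list" where
  "g_0 v = [evl \<beta> w *s v!0,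
    - \<iota> (inverse q) *s evl \<beta> wt *s v!0,
    \<iota> (inverse q) *s Ry (evl \<alpha> w *s v!0),
    0]"

definition g_1 :: "'m list \<Rightarrow> 'm list" where
  "g_1 v = [- \<iota> (inverse q) *s evl \<beta> wt *s v!1 - \<iota> (inverse q) *s Ry (evl \<alpha> w *s v!2),
    evl \<beta> w *s v!0,
    Ry (evl \<alpha> w *s v!0) + \<iota> q *s bdiff zt wt *s v!2 - bdiff z w *s v!2]"

definition g_2 :: "'m list \<Rightarrow> 'm list" where
  "g_2 v = [- evl \<beta> w *s v!0 + \<iota> (inverse q) *s evl \<beta> wt *s v!1 - \<iota> (inverse q) *s Ry (evl \<alpha> w *s v!2)]"

definition f_0 :: "'m list \<Rightarrow> 'm list" where
  "f_0 v = [ddiff p z w *s v!0 + \<iota> q *s Rx (v!2) - Ly (v!3)]"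

definition f_1 :: "'m list \<Rightarrow> 'm list" where
  "f_1 v = [ddiff p zt w *s v!1 + Rx (v!2),
    - \<iota> q *s ddiff p z wt *s v!0 - Ly (v!2),
    - \<iota> q *s Rx (v!0) + Ly (v!1)]"

definition f_2 :: "'m list \<Rightarrow> 'm list" where
  "f_2 v = [0,
    \<iota> q *s ddiff p zt wt *s v!0,
    - \<iota> q *s Rx (v!0),
    \<iota> q *s Ly (v!0)]"

definition s_h1 :: "'m list \<Rightarrow> 'm list" where
  "s_h1 v = [bdiff z w *s v!2]"

definition s_h2 :: "'m list \<Rightarrow> 'm list" where
  "s_h2 v = [bdiff zt w *s v!2,
    - Ry (evl \<alpha> w *s v!0) + bdiff z wt *s v!3,
    evl \<beta> w *s v!0]"

text \<open>Each entry stands at the transposed position of its partner in \<open>s_d2\<close>, just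
  as \<open>s_h4\<close> is matched with \<open>s_d3\<close>. The entries paired with
  \<open>1 \<otimes> x\<close> and with divided differences have the opposite sign to their
  partners, because \<open>d h + h d = -1\<close> is required.\<close>

definition s_h3 :: "'m list \<Rightarrow> 'm list" where
  "s_h3 v = [bdiff z w *s v!2,
    Ry (evl \<alpha> w *s v!0) + bdiff zt wt *s v!3,
    evl \<beta> w *s v!0,
    evl \<beta> wt *s v!1 + Ry (evl \<alpha> w *s v!2)]"

definition s_h4 :: "'m list \<Rightarrow> 'm list" where
  "s_h4 v = [bdiff zt w *s v!2,
    - Ry (evl \<alpha> w *s v!0) + bdiff z wt *s v!3,
    evl \<beta> w *s v!0,
    evl \<beta> wt *s v!1 - Ry (evl \<alpha> w *s v!2)]"

definition t_h0 :: "'m list \<Rightarrow> 'm list" where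
  "t_h0 v = [0,
    0,
    - \<iota> q *s bdiff zt wt *s v!0]"

definition t_h1 :: "'m list \<Rightarrow> 'm list" where
  "t_h1 v = [0,
    - \<iota> (inverse q) *s Ry (evl \<alpha> w *s v!1) + \<iota> (inverse q) *s evl \<beta> wt *s v!2,
    - bdiff z wt *s v!0,
    - bdiff zt w *s v!1]"

definition t_h2 :: "'m list \<Rightarrow> 'm list" where
  "t_h2 v = [- \<iota> (inverse q) *s Ry (evl \<alpha> w *s v!0) + evl \<beta> wt *s v!2,
    evl \<beta> w *s v!3,
    - bdiff z w *s v!0,
    - bdiff zt wt *s v!1 + \<iota> (inverse q) *s Ry (evl \<alpha> w *s v!3)]"

definition t_h3 :: "'m list \<Rightarrow> 'm list" where
  "t_h3 v = [evl \<beta> w *s v!2,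
    - \<iota> (inverse q) *s Ry (evl \<alpha> w *s v!1) + evl \<beta> wt *s v!3,
    - bdiff z wt *s v!0 + \<iota> (inverse q) *s Ry (evl \<alpha> w *s v!2),
    - bdiff zt w *s v!1]"

section \<open>Identities for differentials, cochain maps and homotopies\<close>

lemma s_d1_s_d0: "s_d1 (s_d0 v) = [0, 0, 0, 0]"
  by (simp add: s_d1_def s_d0_def norm_rules sum_rules)

lemma s_d2_s_d1: "s_d2 (s_d1 v) = [0, 0, 0, 0]"
  by (simp add: s_d2_def s_d1_def norm_rules sum_rules)

lemma s_d3_s_d2: "s_d3 (s_d2 v) = [0, 0, 0, 0]"
  by (simp add: s_d3_def s_d2_def norm_rules sum_rules)

lemma s_d2_s_d3: "s_d2 (s_d3 v) = [0, 0, 0, 0]"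
  by (simp add: s_d2_def s_d3_def norm_rules sum_rules)

lemma t_d1_t_d2: "t_d1 (t_d2 v) = [0]"
  by (simp add: t_d1_def t_d2_def norm_rules sum_rules)

lemma t_d2_t_d3: "t_d2 (t_d3 v) = [0, 0, 0]"
  by (simp add: t_d2_def t_d3_def norm_rules sum_rules)

lemma t_d3_t_d4: "t_d3 (t_d4 v) = [0, 0, 0, 0]"
  by (simp add: t_d3_def t_d4_def norm_rules sum_rules)

lemma t_d4_t_d3: "t_d4 (t_d3 v) = [0, 0, 0, 0]"
  by (simp add: t_d4_def t_d3_def norm_rules sum_rules)

text \<open>This and \<open>s_d2_f_2\<close> are the boundary cases of the cochain map property: as
  \<open>f\<close> is zero outside degrees 0, 1, 2, the other composite must vanish by itself in
  degrees -1 and 2.\<close>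

lemma f_0_t_d3: "f_0 (t_d3 v) = [0]"
  by (simp add: f_0_def t_d3_def norm_rules sum_rules)

lemma s_d2_f_2: "s_d2 (f_2 v) = [0, 0, 0, 0]"
  by (simp add: s_d2_def f_2_def norm_rules sum_rules)

lemma g_1_s_d0: "g_1 (s_d0 v) = t_d2 (g_0 v)"
  by (simp add: g_1_def s_d0_def t_d2_def g_0_def norm_rules sum_rules)

lemma g_2_s_d1: "g_2 (s_d1 v) = t_d1 (g_1 v)"
  by (simp add: g_2_def s_d1_def t_d1_def g_1_def norm_rules sum_rules)

lemma f_1_t_d2: "f_1 (t_d2 v) = s_d0 (f_0 v)"
  by (simp add: f_1_def t_d2_def s_d0_def f_0_def norm_rules sum_rules)

lemma f_2_t_d1: "f_2 (t_d1 v) = s_d1 (f_1 v)"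
  by (simp add: f_2_def t_d1_def s_d1_def f_1_def norm_rules sum_rules)

text \<open>The list \<open>[v!0]\<close> stands for \<open>v\<close>, whose length is fixed only
  when \<open>vec_of_list_nth\<close> is applied. There is no \<open>d h\<close> summand since the
  homotopy is zero on degree 0.\<close>

lemma homotopy_s_0: "f_0 (g_0 v) = map2 (+) [v!0] (s_h1 (s_d0 v))"
  by (simp add: f_0_def g_0_def s_d0_def s_h1_def norm_rules sum_rules)

lemma homotopy_s_1: "f_1 (g_1 v) = map2 (+) [v!0, v!1, v!2] (map2 (+) (s_d0 (s_h1 v)) (s_h2 (s_d1 v)))"
  by (simp add: f_1_def g_1_def s_d0_def s_d1_def s_h1_def s_h2_def norm_rules sum_rules)

lemma homotopy_s_2: "f_2 (g_2 v) = map2 (+) [v!0, v!1, v!2, v!3] (map2 (+) (s_d1 (s_h2 v)) (s_h3 (s_d2 v)))"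
  by (simp add: f_2_def g_2_def s_d1_def s_d2_def s_h2_def s_h3_def norm_rules sum_rules)

text \<open>From degree 3 on the composite of \<open>f\<close> and \<open>g\<close> is zero, so the
  homotopy has to contract the complex there.\<close>

lemma homotopy_s_odd: "[0, 0, 0, 0] = map2 (+) [v!0, v!1, v!2, v!3] (map2 (+) (s_d2 (s_h3 v)) (s_h4 (s_d3 v)))"
  by (simp add: s_d2_def s_d3_def s_h3_def s_h4_def norm_rules sum_rules)

lemma homotopy_s_even: "[0, 0, 0, 0] = map2 (+) [v!0, v!1, v!2, v!3] (map2 (+) (s_d3 (s_h4 v)) (s_h3 (s_d2 v)))"
  by (simp add: s_d2_def s_d3_def s_h3_def s_h4_def norm_rules sum_rules)

lemma homotopy_t_0: "g_2 (f_2 v) = map2 (+) [v!0] (t_d1 (t_h0 v))"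
  by (simp add: f_2_def g_2_def t_d1_def t_h0_def norm_rules sum_rules)

lemma homotopy_t_1: "g_1 (f_1 v) = map2 (+) [v!0, v!1, v!2] (map2 (+) (t_d2 (t_h1 v)) (t_h0 (t_d1 v)))"
  by (simp add: f_1_def g_1_def t_d1_def t_d2_def t_h0_def t_h1_def norm_rules sum_rules)

lemma homotopy_t_2: "g_0 (f_0 v) = map2 (+) [v!0, v!1, v!2, v!3] (map2 (+) (t_d3 (t_h2 v)) (t_h1 (t_d2 v)))"
  by (simp add: f_0_def g_0_def t_d2_def t_d3_def t_h1_def t_h2_def norm_rules sum_rules)

lemma homotopy_t_odd: "[0, 0, 0, 0] = map2 (+) [v!0, v!1, v!2, v!3] (map2 (+) (t_d4 (t_h3 v)) (t_h2 (t_d3 v)))"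
  by (simp add: t_d3_def t_d4_def t_h2_def t_h3_def norm_rules sum_rules)

lemma homotopy_t_even: "[0, 0, 0, 0] = map2 (+) [v!0, v!1, v!2, v!3] (map2 (+) (t_d3 (t_h2 v)) (t_h3 (t_d4 v)))"
  by (simp add: t_d3_def t_d4_def t_h2_def t_h3_def norm_rules sum_rules)

end

section \<open>The algebra and its bimodules\<close>

lemma carrier_ring_of_type_algebra [simp]: "carrier ring_of_type_algebra = UNIV"
  and mult_ring_of_type_algebra [simp]: "a \<otimes>\<^bsub>ring_of_type_algebra\<^esub> b = a * b"
  and one_ring_of_type_algebra [simp]: "\<one>\<^bsub>ring_of_type_algebra\<^esub> = 1"
  and zero_ring_of_type_algebra [simp]: "\<zero>\<^bsub>ring_of_type_algebra\<^esub> = 0"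
  and add_ring_of_type_algebra [simp]: "a \<oplus>\<^bsub>ring_of_type_algebra\<^esub> b = a + b"
  by (simp_all add: ring_of_type_algebra_def)

lemma ring_ring_of_type_algebra: "ring (ring_of_type_algebra :: 'a :: ring_1 ring)"
proof -
  have "\<exists>y. x + y = 0" for x :: 'a using add.right_inverse by blast
  moreover have "\<exists>y. x + y = 0 \<and> y + x = 0" for x :: 'a by (rule exI[of _ "- x"]) simp
  ultimately show ?thesis by unfold_locales (auto simp: algebra_simps Units_def)
qed

lemma a_minus_ring_of_type_algebra [simp]:
  "a \<ominus>\<^bsub>ring_of_type_algebra\<^esub> b = a - (b :: 'a :: ring_1)"
proof -
  interpret ring "ring_of_type_algebra :: 'a ring" by (rule ring_ring_of_type_algebra)
  have "\<ominus>\<^bsub>ring_of_type_algebra\<^esub> b = - b"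
    using minus_equality[of "- b" b] by simp
  then show ?thesis by (simp add: a_minus_def)
qed

lemma ideal_gwa_ideal: "ideal (gwa_ideal q p) ring_of_type_algebra"
  unfolding gwa_ideal_def by (intro ring.genideal_ideal ring_ring_of_type_algebra) simp

lemma gwa_class_hom: "gwa_class q p \<in> Ring.ring_hom ring_of_type_algebra (gwa q p)"
  unfolding gwa_class_def gwa_def by (rule ideal.rcos_ring_hom[OF ideal_gwa_ideal])

lemma gwa_class_carrier [simp]: "gwa_class q p u \<in> carrier (gwa q p)"
  using ring_hom_closed[OF gwa_class_hom] by simp

lemma gwa_class_mult: "gwa_class q p u \<otimes>\<^bsub>gwa q p\<^esub> gwa_class q p v = gwa_class q p (u * v)"
  using ring_hom_mult[OF gwa_class_hom, of u v] by simp

lemma gwa_class_add: "gwa_class q p u \<oplus>\<^bsub>gwa q p\<^esub> gwa_class q p v = gwa_class q p (u + v)"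
  using ring_hom_add[OF gwa_class_hom, of u v] by simp

lemma gunit_eq: "gunit q p = gwa_class q p 1"
  using ring_hom_one[OF gwa_class_hom, of q p] by (simp add: gunit_def)

lemma gwa_class_eqI:
  assumes "u - v \<in> gwa_relators q p"
  shows "gwa_class q p u = gwa_class q p v"
proof -
  interpret ring "ring_of_type_algebra :: 'a free_alg ring" by (rule ring_ring_of_type_algebra)
  interpret ideal "gwa_ideal q p" ring_of_type_algebra by (rule ideal_gwa_ideal)
  have "u - v \<in> gwa_ideal q p"
    using genideal_self[of "gwa_relators q p"] assms by (auto simp: gwa_ideal_def)
  then show ?thesis
    using quotient_eq_iff_same_a_r_cos[OF ideal_gwa_ideal, of u v] by (simp add: gwa_class_def)
qed

section \<open>Scalars and polynomials in \<open>z\<close> inside the free algebra\<close>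

lemma free_scalar_hom:
  "free_scalar 0 = 0" "free_scalar 1 = 1" "free_scalar (a + b) = free_scalar a + free_scalar b"
  "free_scalar (a * b) = free_scalar a * free_scalar b"
  by (simp_all add: free_scalar_def single_add mult_single flip: zero_list_def)

lemma free_poly_eq_sum:
  assumes "Polynomial.degree \<phi> \<le> n"
  shows "free_poly \<phi> = (\<Sum>i\<le>n. Poly_Mapping.single (replicate i Gen_z) (poly.coeff \<phi> i))"
  unfolding free_poly_def using assms by (intro sum.mono_neutral_left) (auto simp: coeff_eq_0)

lemma free_poly_add: "free_poly (\<phi> + \<psi>) = free_poly \<phi> + free_poly \<psi>"
proof -
  let ?n = "max (Polynomial.degree \<phi>) (Polynomial.degree \<psi>)"
  show ?thesis
    by (simp add: free_poly_eq_sum[of _ ?n] degree_add_le sum.distrib single_add)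
qed

lemma free_poly_0 [simp]: "free_poly 0 = 0"
  by (simp add: free_poly_def)

lemma free_poly_pCons: "free_poly (pCons c \<phi>) = free_scalar c + free_gen Gen_z * free_poly \<phi>"
  by (simp add: free_poly_eq_sum[of "pCons c \<phi>" "Suc (Polynomial.degree \<phi>)"] degree_pCons_le
      sum.atMost_Suc_shift free_poly_def free_scalar_def free_gen_def sum_distrib_left mult_single plus_list_def
      del: sum.atMost_Suc)

lemma free_poly_const: "free_poly [:c:] = free_scalar c"
  by (simp add: free_poly_pCons)

lemma free_poly_z: "free_poly [:0, 1:] = free_gen Gen_z"
  by (simp add: free_poly_pCons free_scalar_hom)

text \<open>Reduces additive statements on the free algebra to multiples of single words.\<close>

lemma poly_mapping_single_induct [case_names zero single add]:
  assumes "P 0" and single: "\<And>k c. P (Poly_Mapping.single k c)"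
    and add: "\<And>s t :: 'a \<Rightarrow>\<^sub>0 'b :: comm_monoid_add. P s \<Longrightarrow> P t \<Longrightarrow> P (s + t)"
  shows "P t"
proof (induction t rule: update_induct)
  case (update f a b)
  have "Poly_Mapping.update a b f = f + Poly_Mapping.single a b"
    using update(1) by (intro poly_mapping_eqI)
      (auto simp: lookup_update lookup_add lookup_single in_keys_iff when_def)
  then show ?case using add[OF update(3) single] by simp
qed (rule assms(1))

lemma free_scalar_central: "free_scalar c * u = u * free_scalar c"
proof (induction u rule: poly_mapping_single_induct)
  case (single k v)
  then show ?case by (simp add: free_scalar_def mult_single plus_list_def mult.commute)
qed (simp_all add: algebra_simps)

lemma free_poly_smult: "free_poly (Polynomial.smult c \<phi>) = free_scalar c * free_poly \<phi>"
  by (induction \<phi>)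
    (simp_all add: free_poly_pCons free_scalar_hom distrib_left free_scalar_central[of c] mult.assoc)

lemma free_poly_mult: "free_poly (\<phi> * \<psi>) = free_poly \<phi> * free_poly \<psi>"
  by (induction \<phi>)
    (simp_all add: mult_pCons_left free_poly_add free_poly_smult free_poly_pCons free_scalar_hom
      distrib_right mult.assoc)

locale gwa_module =
  fixes q :: "'k :: field" and p :: "'k poly"
    and lact :: "'k free_alg set \<Rightarrow> 'm :: ab_group_add \<Rightarrow> 'm" and ract
  assumes bimodule: "gwa_bimodule q p lact ract" and q_nonzero: "q \<noteq> 0"
begin

text \<open>Acting through representatives in the free algebra avoids carrier conditions and turns
  each relator into an equation of operators.\<close>

definition L where "L u = lact (gwa_class q p u)"
definition R where "R u m = ract m (gwa_class q p u)"

sublocale central_bimodule "gwa q p" "gscal q p" lact ract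
  using bimodule by (simp add: gwa_bimodule_def)

lemma L_add: "L u (m + n) = L u m + L u n" and R_add: "R u (m + n) = R u m + R u n"
  and add_L: "L (u + v) m = L u m + L v m" and add_R: "R (u + v) m = R u m + R v m"
  and L_mult: "L (u * v) m = L u (L v m)" and R_mult: "R (u * v) m = R v (R u m)"
  and L_one: "L 1 m = m" and R_one: "R 1 m = m" and L_R: "L u (R v m) = R v (L u m)"
  and scalar_L_R: "L (free_scalar c) m = R (free_scalar c) m"
  by (simp_all add: L_def R_def lact_add ract_add add_lact add_ract mult_lact mult_ract lact_ract
      one_lact[unfolded gunit_eq[unfolded gunit_def]] one_ract[unfolded gunit_eq[unfolded gunit_def]]
      scalar_central[unfolded gscal_def]
      flip: gwa_class_add gwa_class_mult)

lemma L_zero [simp]: "L u 0 = 0" and R_zero [simp]: "R u 0 = 0"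
  and zero_L [simp]: "L 0 m = 0" and zero_R [simp]: "R 0 m = 0"
  using L_add[of u 0 0] R_add[of u 0 0] add_L[of 0 0 m] add_R[of 0 0 m] by simp_all

lemma L_relator: "u - v \<in> gwa_relators q p \<Longrightarrow> L u = L v"
  and R_relator: "u - v \<in> gwa_relators q p \<Longrightarrow> R u = R v"
  by (simp_all add: L_def R_def fun_eq_iff gwa_class_eqI[of u v])

text \<open>A polynomial in \<open>z\<close> over \<open>k[w]\<close> acts with \<open>z\<close> from the left and \<open>w\<close> from the right.\<close>

definition act :: "'k poly poly \<Rightarrow> 'm \<Rightarrow> 'm" where
  "act F m = fold_coeffs (\<lambda>c n. R (free_poly c) m + L (free_gen Gen_z) n) F 0"

lemma act_0 [simp]: "act 0 m = 0"
  by (simp add: act_def)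

lemma act_pCons: "act (pCons c F) m = R (free_poly c) m + L (free_gen Gen_z) (act F m)"
  \<comment> \<open>The recursion for \<open>fold_coeffs\<close> excludes \<open>pCons 0 0\<close>,
    which is the zero polynomial and is treated apart.\<close>
  by (cases "c = 0 \<and> F = 0") (auto simp: act_def fold_coeffs_pCons_coeff_not_0_eq fold_coeffs_pCons_not_0_0_eq)

lemma act_const: "act [:c:] m = R (free_poly c) m"
  by (simp add: act_pCons)

lemma act_add: "act (F + G) m = act F m + act G m"
  by (induction F G rule: poly_induct2) (simp_all add: act_pCons free_poly_add add_R L_add add_ac)

lemma act_add_right: "act F (m + n) = act F m + act F n"
  by (induction F) (simp_all add: act_pCons R_add L_add add_ac)

lemma act_smult: "act (Polynomial.smult c F) m = R (free_poly c) (act F m)"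
proof (induction F)
  case (pCons d F)
  \<comment> \<open>Right multiplication reverses products; commutativity of polynomials in one
    variable makes it a left action nevertheless.\<close>
  have "free_poly (c * d) = free_poly d * free_poly c" by (simp add: free_poly_mult[symmetric] mult.commute)
  then show ?case by (simp add: act_pCons pCons.IH R_mult R_add L_R)
qed simp

lemma act_mult: "act (F * G) m = act F (act G m)"
  by (induction F) (simp_all add: mult_pCons_left act_add act_smult act_pCons)

lemma act_one: "act 1 m = m"
  by (simp add: one_pCons act_pCons free_poly_const free_scalar_hom R_one)

end

text \<open>The ring \<open>k[z, w]\<close> is encoded as \<open>k[w][z]\<close>, with
  \<open>w\<close> the inner and \<open>z\<close> the outer variable.\<close>

definition cst :: "'k :: field \<Rightarrow> 'k poly poly" where "cst c = [:[:c:]:]"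

definition zz :: "'k :: field poly poly" where "zz = [:0, 1:]"

definition ww :: "'k :: field poly poly" where "ww = [:[:0, 1:]:]"

interpretation cst: scalar_hom cst
  by unfold_locales (simp_all add: cst_def one_pCons)

context gwa_module
begin

abbreviation "fx \<equiv> free_gen Gen_x :: 'k free_alg"
abbreviation "fy \<equiv> free_gen Gen_y :: 'k free_alg"
abbreviation "fz \<equiv> free_gen Gen_z :: 'k free_alg"

lemma act_cst: "act (cst c) m = R (free_scalar c) m"
  by (simp add: cst_def act_const free_poly_const)

lemma act_zz: "act zz m = L fz m"
  by (simp add: zz_def act_pCons) (simp add: one_pCons free_poly_const free_scalar_hom R_one)

lemma act_ww: "act ww m = R fz m"
  by (simp add: ww_def act_const free_poly_z)

lemma act_evl_zz: "act (cst.evl \<phi> zz) m = L (free_poly \<phi>) m"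
  by (induction \<phi>)
    (simp_all add: cst.evl_pCons free_poly_pCons act_add act_mult add_L L_mult act_cst act_zz scalar_L_R)

lemma act_evl_ww: "act (cst.evl \<phi> ww) m = R (free_poly \<phi>) m"
proof (induction \<phi> arbitrary: m)
  case (pCons c \<phi>)
  have "R fz (R (free_poly \<phi>) m) = R (free_poly ([:0, 1:] * \<phi>)) m"
    by (subst mult.commute) (simp only: free_poly_mult free_poly_z R_mult)
  then show ?case
    by (simp add: cst.evl_pCons free_poly_pCons act_add act_mult add_R act_cst act_ww pCons.IH
        free_poly_mult[of "[:0, 1:]", unfolded free_poly_z, symmetric] del: mult_pCons_left)
qed simp

lemma gwa_relators:
  "fx * fz - free_scalar q * fz * fx \<in> gwa_relators q p"
  "fy * fz - free_scalar (inverse q) * fz * fy \<in> gwa_relators q p"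
  "fy * fx - free_poly p \<in> gwa_relators q p"
  "fx * fy - free_poly (twist q p) \<in> gwa_relators q p"
  by (auto simp: gwa_relators_def)

lemma L_scalar: "L u (L (free_scalar c) m) = L (free_scalar c) (L u m)"
  by (simp add: free_scalar_central flip: L_mult)

lemma R_scalar: "R u (R (free_scalar c) m) = R (free_scalar c) (R u m)"
  by (simp add: free_scalar_central flip: R_mult)

lemma L_cst: "L u (act (cst c) m) = act (cst c) (L u m)"
  unfolding act_cst scalar_L_R[symmetric] by (rule L_scalar)

lemma R_cst: "R u (act (cst c) m) = act (cst c) (R u m)"
  unfolding act_cst by (rule R_scalar)

lemma scalar_cancel:
  "L (free_scalar q) (L (free_scalar (inverse q)) m) = m"
  "R (free_scalar q) (R (free_scalar (inverse q)) m) = m"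
  using q_nonzero by (simp_all add: L_one R_one free_scalar_hom(2) flip: L_mult R_mult free_scalar_hom(4))

lemmas L_rel = gwa_relators[THEN L_relator, THEN fun_cong, unfolded L_mult]
lemmas R_rel = gwa_relators[THEN R_relator, THEN fun_cong, unfolded R_mult]

end

locale gwa_smooth_module = gwa_module q p lact ract
  for q :: "'k :: field" and p :: "'k poly"
    and lact :: "'k free_alg set \<Rightarrow> 'm :: ab_group_add \<Rightarrow> 'm" and ract +
  fixes \<alpha> \<beta> :: "'k poly"
  assumes bezout: "\<alpha> * p + \<beta> * pderiv p = 1"
begin

text \<open>The commutation axioms are the defining relations read as operator identities. Each
  relation is used on both sides: \<open>xz = qzx\<close> moves \<open>Lx\<close> past
  \<open>zz\<close> and, in reversed order, \<open>Rx\<close> past \<open>ww\<close>.\<close>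

sublocale gwa_operators cst act q p \<alpha> \<beta> zz ww "L fx" "L fy" "R fx" "R fy"
proof unfold_locales
  have cstL: "act (cst c) m = L (free_scalar c) m" for c m by (simp add: act_cst scalar_L_R)
  show "L fy (act (cst q * zz) m) = act zz (L fy m)" for m
    using L_rel(2)[of m]
    by (simp add: act_mult cstL act_zz L_scalar[of fy] scalar_cancel)
  show "R fx (act (cst q * ww) m) = act ww (R fx m)" for m
    using R_rel(1)[of m] by (simp add: act_mult act_cst act_ww R_scalar[of fz])
  show "R fy (act ww m) = act (cst q * ww) (R fy m)" for m
    using R_rel(2)[of m]
    by (simp add: act_mult act_cst act_ww R_scalar[of fy] R_scalar[of fz] scalar_cancel)
  show "L fy (L fx m) = act (cst.evl p zz) m" "L fx (L fy m) = act (cst.evl p (cst q * zz)) m" for m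
    by (simp_all only: L_rel act_evl_zz flip: cst.evl_twist)
  show "R fx (R fy m) = act (cst.evl p ww) m" "R fy (R fx m) = act (cst.evl p (cst q * ww)) m" for m
    by (simp_all only: R_rel act_evl_ww flip: cst.evl_twist)
  show "L fx (act zz m) = act (cst q * zz) (L fx m)" for m
    by (simp only: act_mult cstL act_zz L_rel)
qed (simp_all add: L_cst R_cst q_nonzero bezout act_add_right act_add act_mult act_one L_add R_add act_zz act_ww L_R)

definition lin :: "('m \<Rightarrow> 'm) \<Rightarrow> bool" where
  "lin h \<longleftrightarrow> (\<forall>m n. h (m + n) = h m + h n) \<and> (\<forall>c m. h (act (cst c) m) = act (cst c) (h m))"

abbreviation "ev \<equiv> env_act (gscal q p) lact ract"

lemma ev_eq: "ev t m = (\<Sum>k\<in>Poly_Mapping.keys t.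
    act (cst (Poly_Mapping.lookup t k)) (ract (lact (fst k) m) (snd k)))"
  by (simp add: env_act_def case_prod_unfold gscal_def act_cst scalar_L_R[symmetric] L_def)

lemma ev_zero [simp]: "ev 0 m = 0"
  by (simp add: ev_eq)

text \<open>The coefficients enter additively, and keys that cancel in \<open>s + t\<close>
  contribute zero.\<close>

lemma ev_add: "ev (s + t) m = ev s m + ev t m"
  unfolding ev_eq by (rule setsum_keys_plus_distrib) (simp_all add: cst.hom_add act_add)

lemma ev_minus: "ev (- t) m = - ev t m"
  using ev_add[of t "- t" m] by (simp add: eq_neg_iff_add_eq_0 add.commute)

lemma ev_diff: "ev (s - t) m = ev s m - ev t m"
  using ev_add[of s "- t" m] by (simp add: ev_minus)

lemma ev_sum: "ev (sum t I) m = (\<Sum>i\<in>I. ev (t i) m)"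
  by (induction I rule: infinite_finite_induct) (simp_all add: ev_add)

lemma ev_single:
  "ev (Poly_Mapping.single (gwa_class q p u, gwa_class q p v) c) m = act (cst c) (R v (L u m))"
  by (cases "c = 0") (simp_all add: ev_eq L_def R_def)

lemma ev_tens: "ev (gwa_class q p u \<boxtimes> gwa_class q p v) m = R v (L u m)"
  by (simp add: tens_def ev_single act_one)

lemma tens_map_add: "tens_map \<phi> \<psi> (s + t) = tens_map \<phi> \<psi> s + tens_map \<phi> \<psi> t"
  using setsum_keys_plus_distrib[of "\<lambda>k. Poly_Mapping.single (\<phi> (fst k), \<psi> (snd k))" s t]
  by (simp add: tens_map_def case_prod_unfold single_add)

lemma tens_map_single:
  "tens_map \<phi> \<psi> (Poly_Mapping.single (a, b) c) = Poly_Mapping.single (\<phi> a, \<psi> b) c"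
  by (cases "c = 0") (simp_all add: tens_map_def)

lemma tens_map_sum: "tens_map \<phi> \<psi> (sum t I) = (\<Sum>i\<in>I. tens_map \<phi> \<psi> (t i))"
  by (induction I rule: infinite_finite_induct) (simp_all add: tens_map_add, simp_all add: tens_map_def)

lemma act_sum: "act (sum F I) m = (\<Sum>i\<in>I. act (F i) m)"
  by (induction I rule: infinite_finite_induct) (simp_all add: act_add)

lemma ev_p12: "ev (p12 q p \<phi> \<psi>) m = act (\<Sum>i\<le>Polynomial.degree p. \<Sum>j=1..i. cst (poly.coeff p i) *
   (cst.evl (\<phi> (Polynomial.monom 1 (i - j))) zz * cst.evl (\<psi> (Polynomial.monom 1 (j - 1))) ww)) m"
  by (simp add: p12_def dpoly_def tens_map_sum tens_map_single gpol_def ev_sum ev_single act_sum act_mult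
      act_evl_zz act_evl_ww L_R)

text \<open>A twist becomes evaluation at \<open>zt\<close> or \<open>wt\<close>, and
  differentiating the monomial of degree \<open>j - 1\<close> produces the exponent
  \<open>j - 2\<close> of \<open>ddiff'\<close>.\<close>

lemma ev_p12_simps:
  "ev (p12 q p id id) m = act (cst.ddiff p zz ww) m"
  "ev (p12 q p (twist q) id) m = act (cst.ddiff p zt ww) m"
  "ev (p12 q p id (twist q)) m = act (cst.ddiff p zz wt) m"
  "ev (p12 q p (twist q) (twist q)) m = act (cst.ddiff p zt wt) m"
  "ev (p12 q p (\<lambda>u. Polynomial.smult q (twist q u)) (twist q)) m = act (cst q) (act (cst.ddiff p zt wt) m)"
  "ev (p12 q p (Polynomial.smult q) (twist q)) m = act (cst q) (act (cst.ddiff p zz wt) m)"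
  "ev (p12 q p id (\<lambda>v. \<beta> * pderiv v)) m = act (bdiff zz ww) m"
  "ev (p12 q p (twist q) (\<lambda>v. \<beta> * pderiv v)) m = act (bdiff zt ww) m"
  "ev (p12 q p id (\<lambda>v. twist q (\<beta> * pderiv v))) m = act (bdiff zz wt) m"
  "ev (p12 q p (twist q) (\<lambda>v. twist q (\<beta> * pderiv v))) m = act (bdiff zt wt) m"
  "ev (p12 q p (\<lambda>u. Polynomial.smult q (twist q u)) (\<lambda>v. twist q (\<beta> * pderiv v))) m
    = act (cst q) (act (bdiff zt wt) m)"
  unfolding ev_p12 act_mult[symmetric]
  by (intro arg_cong2[of _ _ _ _ act] refl;
    simp add: bdiff_def cst.ddiff_def cst.ddiff'_def cst.evl_twist cst.evl_smult cst.evl_monom cst.evl_mult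
      pderiv_monom cst.hom_of_nat sum_distrib_left mult_ac numeral_2_eq_2 del: of_nat_diff)+

lemma lin_act: "lin (act F)"
  by (simp add: lin_def act_add_right flip: act_mult) (simp add: mult.commute)

lemma lin_L: "lin (L u)"
  by (simp add: lin_def L_add L_cst)

lemma lin_R: "lin (R u)"
  by (simp add: lin_def R_add R_cst)

lemma lin_comp: "lin h \<Longrightarrow> lin k \<Longrightarrow> lin (\<lambda>m. h (k m))"
  by (simp add: lin_def)

lemma lin_ev:
  "lin (ev 0)" "lin (ev s) \<Longrightarrow> lin (ev (- s))" "lin (ev s) \<Longrightarrow> lin (ev t) \<Longrightarrow> lin (ev (s - t))"
  "lin (ev (gwa_class q p u \<boxtimes> gwa_class q p v))" "lin (ev (p12 q p \<phi> \<psi>))"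
proof -
  show "lin (ev 0)" by (simp add: lin_def)
  show "lin (ev (- s))" if "lin (ev s)" using that by (simp add: lin_def ev_minus scale_minus_right)
  show "lin (ev (s - t))" if "lin (ev s)" "lin (ev t)"
    using that by (simp add: lin_def ev_diff scale_right_diff_distrib)
  show "lin (ev (gwa_class q p u \<boxtimes> gwa_class q p v))"
    using lin_comp[OF lin_R lin_L] by (simp add: ev_tens[abs_def])
  show "lin (ev (p12 q p \<phi> \<psi>))" using lin_act by (simp add: ev_p12[abs_def])
qed

end

section \<open>Matrices over the enveloping algebra\<close>

lemma mat_act_rows: "mat_act \<eta> l r (mat_of_rows_list n rs) v =
    vec_of_list (map (\<lambda>row. \<Sum>j<n. env_act \<eta> l r (row ! j) (vec_index v j)) rs)"
  by (intro eq_vecI) (auto simp: mat_act_def mat_of_rows_list_def vec_of_list_index)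

lemma sum_lessThan_numeral:
  "(\<Sum>j<1. h j) = h (0::nat)" "(\<Sum>j<Suc 0. h j) = h (0::nat)" "(\<Sum>j<3. h j) = h 0 + h 1 + h (2::nat)"
  "(\<Sum>j<4. h j) = h 0 + h 1 + h 2 + h (3::nat)"
  by (simp_all add: numeral_eq_Suc add_ac)

context gwa_smooth_module
begin

abbreviation "m_\<beta> \<equiv>
  gunit q p \<boxtimes> gpol q p \<beta> :: ('k, 'k free_alg set, 'k free_alg set) tens"
abbreviation "m_\<beta>t \<equiv>
  gunit q p \<boxtimes> gpol q p (twist q \<beta>) :: ('k, 'k free_alg set, 'k free_alg set) tens"
abbreviation "m_\<alpha>y \<equiv>
  gunit q p \<boxtimes> (gpol q p \<alpha> \<otimes>\<^bsub>gwa q p\<^esub> gy q p) :: ('k, 'k free_alg set, 'k free_alg set) tens"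
abbreviation "m_q\<alpha>y \<equiv>
  gscal q p (inverse q) \<boxtimes> (gpol q p \<alpha> \<otimes>\<^bsub>gwa q p\<^esub> gy q p) :: ('k, 'k free_alg set, 'k free_alg set) tens"
abbreviation "m_q\<beta>t \<equiv>
  gscal q p (inverse q) \<boxtimes> gpol q p (twist q \<beta>) :: ('k, 'k free_alg set, 'k free_alg set) tens"
abbreviation "e00 \<equiv> p12 q p id (\<lambda>v. \<beta> * pderiv v)"
abbreviation "e10 \<equiv> p12 q p (twist q) (\<lambda>v. \<beta> * pderiv v)"
abbreviation "e01 \<equiv> p12 q p id (\<lambda>v. twist q (\<beta> * pderiv v))"
abbreviation "e11 \<equiv> p12 q p (twist q) (\<lambda>v. twist q (\<beta> * pderiv v))"
abbreviation "qe11 \<equiv> p12 q p (\<lambda>u. Polynomial.smult q (twist q u)) (\<lambda>v. twist q (\<beta> * pderiv v))"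

text \<open>The homotopies are also given as matrices over the enveloping algebra, so that their
  linearity follows from \<open>mat_act_lin_hom\<close> as for the differentials.\<close>

definition S_h1 :: "'k env_mat" where
  "S_h1 = mat_of_rows_list 3 [[0, 0, e00]]"

definition S_h2 :: "'k env_mat" where
  "S_h2 = mat_of_rows_list 4 [[0, 0, e10, 0],
    [- m_\<alpha>y, 0, 0, e01],
    [m_\<beta>, 0, 0, 0]]"

definition S_h3 :: "'k env_mat" where
  "S_h3 = mat_of_rows_list 4 [[0, 0, e00, 0],
    [m_\<alpha>y, 0, 0, e11],
    [m_\<beta>, 0, 0, 0],
    [0, m_\<beta>t, m_\<alpha>y, 0]]"

definition S_h4 :: "'k env_mat" where
  "S_h4 = mat_of_rows_list 4 [[0, 0, e10, 0],
    [- m_\<alpha>y, 0, 0, e01],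
    [m_\<beta>, 0, 0, 0],
    [0, m_\<beta>t, - m_\<alpha>y, 0]]"

definition T_h0 :: "'k env_mat" where
  "T_h0 = mat_of_rows_list 1 [[0],
    [0],
    [- qe11]]"

definition T_h1 :: "'k env_mat" where
  "T_h1 = mat_of_rows_list 3 [[0, 0, 0],
    [0, - m_q\<alpha>y, m_q\<beta>t],
    [- e01, 0, 0],
    [0, - e10, 0]]"

definition T_h2 :: "'k env_mat" where
  "T_h2 = mat_of_rows_list 4 [[- m_q\<alpha>y, 0, m_\<beta>t, 0],
    [0, 0, 0, m_\<beta>],
    [- e00, 0, 0, 0],
    [0, - e11, 0, m_q\<alpha>y]]"

definition T_h3 :: "'k env_mat" where
  "T_h3 = mat_of_rows_list 4 [[0, 0, m_\<beta>, 0],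
    [0, - m_q\<alpha>y, 0, m_\<beta>t],
    [- e01, 0, m_q\<alpha>y, 0],
    [0, - e10, 0, 0]]"

lemmas generator_defs = gx_def gy_def gz_def gzt_def gscal_def gpol_def gunit_eq gwa_class_mult

lemmas ev_rules = ev_minus ev_diff ev_tens ev_p12_simps L_mult R_mult L_one R_one
  scalar_L_R act_zz[symmetric] act_ww[symmetric] act_evl_zz[symmetric] act_evl_ww[symmetric]
  act_cst[symmetric] cst.evl_twist cst.evl_pCons

lemmas mat_act_rules = mat_act_rows vec_of_list_index sum_lessThan_numeral generator_defs ev_rules

section \<open>Matrix actions in coordinates\<close>

lemma mat_act_s_d0: "mat_act (gscal q p) lact ract (S_d0 q p) (vec_of_list v) = vec_of_list (s_d0 v)"
  by (simp add: S_d0_def s_d0_def mat_act_rules norm_rules sum_rules)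

lemma mat_act_s_d1: "mat_act (gscal q p) lact ract (S_d1 q p) (vec_of_list v) = vec_of_list (s_d1 v)"
  by (simp add: S_d1_def s_d1_def mat_act_rules norm_rules sum_rules)

lemma mat_act_s_d2: "mat_act (gscal q p) lact ract (S_d2 q p) (vec_of_list v) = vec_of_list (s_d2 v)"
  by (simp add: S_d2_def s_d2_def mat_act_rules norm_rules sum_rules)

lemma mat_act_s_d3: "mat_act (gscal q p) lact ract (S_d3 q p) (vec_of_list v) = vec_of_list (s_d3 v)"
  by (simp add: S_d3_def s_d3_def mat_act_rules norm_rules sum_rules)

lemma mat_act_t_d1: "mat_act (gscal q p) lact ract (T_d1 q p) (vec_of_list v) = vec_of_list (t_d1 v)"
  by (simp add: T_d1_def t_d1_def mat_act_rules norm_rules sum_rules)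

lemma mat_act_t_d2: "mat_act (gscal q p) lact ract (T_d2 q p) (vec_of_list v) = vec_of_list (t_d2 v)"
  by (simp add: T_d2_def t_d2_def mat_act_rules norm_rules sum_rules)

lemma mat_act_t_d3: "mat_act (gscal q p) lact ract (T_d3 q p) (vec_of_list v) = vec_of_list (t_d3 v)"
  by (simp add: T_d3_def t_d3_def mat_act_rules norm_rules sum_rules)

lemma mat_act_t_d4: "mat_act (gscal q p) lact ract (T_d4 q p) (vec_of_list v) = vec_of_list (t_d4 v)"
  by (simp add: T_d4_def t_d4_def mat_act_rules norm_rules sum_rules)

lemma mat_act_g_0: "mat_act (gscal q p) lact ract (g_mat q p \<alpha> \<beta> 0) (vec_of_list v) = vec_of_list (g_0 v)"
  by (simp add: g_mat_def g_0_def mat_act_rules norm_rules sum_rules)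

lemma mat_act_g_1: "mat_act (gscal q p) lact ract (g_mat q p \<alpha> \<beta> 1) (vec_of_list v) = vec_of_list (g_1 v)"
  by (simp add: g_mat_def g_1_def mat_act_rules norm_rules sum_rules)

lemma mat_act_g_2: "mat_act (gscal q p) lact ract (g_mat q p \<alpha> \<beta> 2) (vec_of_list v) = vec_of_list (g_2 v)"
  by (simp add: g_mat_def g_2_def mat_act_rules norm_rules sum_rules)

lemma mat_act_f_0: "mat_act (gscal q p) lact ract (f_mat q p 0) (vec_of_list v) = vec_of_list (f_0 v)"
  by (simp add: f_mat_def f_0_def mat_act_rules norm_rules sum_rules)

lemma mat_act_f_1: "mat_act (gscal q p) lact ract (f_mat q p 1) (vec_of_list v) = vec_of_list (f_1 v)"
  by (simp add: f_mat_def f_1_def mat_act_rules norm_rules sum_rules)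

lemma mat_act_f_2: "mat_act (gscal q p) lact ract (f_mat q p 2) (vec_of_list v) = vec_of_list (f_2 v)"
  by (simp add: f_mat_def f_2_def mat_act_rules norm_rules sum_rules)

lemma mat_act_s_h1: "mat_act (gscal q p) lact ract (S_h1) (vec_of_list v) = vec_of_list (s_h1 v)"
  by (simp add: S_h1_def s_h1_def mat_act_rules norm_rules sum_rules)

lemma mat_act_s_h2: "mat_act (gscal q p) lact ract (S_h2) (vec_of_list v) = vec_of_list (s_h2 v)"
  by (simp add: S_h2_def s_h2_def mat_act_rules norm_rules sum_rules)

lemma mat_act_s_h3: "mat_act (gscal q p) lact ract (S_h3) (vec_of_list v) = vec_of_list (s_h3 v)"
  by (simp add: S_h3_def s_h3_def mat_act_rules norm_rules sum_rules)

lemma mat_act_s_h4: "mat_act (gscal q p) lact ract (S_h4) (vec_of_list v) = vec_of_list (s_h4 v)"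
  by (simp add: S_h4_def s_h4_def mat_act_rules norm_rules sum_rules)

lemma mat_act_t_h0: "mat_act (gscal q p) lact ract (T_h0) (vec_of_list v) = vec_of_list (t_h0 v)"
  by (simp add: T_h0_def t_h0_def mat_act_rules norm_rules sum_rules)

lemma mat_act_t_h1: "mat_act (gscal q p) lact ract (T_h1) (vec_of_list v) = vec_of_list (t_h1 v)"
  by (simp add: T_h1_def t_h1_def mat_act_rules norm_rules sum_rules)

lemma mat_act_t_h2: "mat_act (gscal q p) lact ract (T_h2) (vec_of_list v) = vec_of_list (t_h2 v)"
  by (simp add: T_h2_def t_h2_def mat_act_rules norm_rules sum_rules)

lemma mat_act_t_h3: "mat_act (gscal q p) lact ract (T_h3) (vec_of_list v) = vec_of_list (t_h3 v)"
  by (simp add: T_h3_def t_h3_def mat_act_rules norm_rules sum_rules)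

text \<open>Linearity is not automatic: formal tensors may involve elements outside the carrier,
  about which the bimodule axioms say nothing.\<close>

definition mat_lin :: "'k env_mat \<Rightarrow> bool" where
  "mat_lin N \<longleftrightarrow> (\<forall>i<dim_row N. \<forall>j<dim_col N. lin (ev (N $$ (i, j))))"

lemma mat_lin_rows:
  "(\<forall>r\<in>set rs. length r = n \<and> (\<forall>t\<in>set r. lin (ev t))) \<Longrightarrow> mat_lin (mat_of_rows_list n rs)"
  unfolding mat_lin_def mat_of_rows_list_def by (auto dest!: nth_mem[of _ rs])

lemma mat_lin_zero: "mat_lin (0\<^sub>m a b)"
  by (simp add: mat_lin_def lin_ev)

text \<open>The size 1 is written \<open>Suc 0\<close>, the form to which the simplifier brings
  it.\<close>

lemma mat_lin_s_d0: "mat_lin (S_d0 q p)" "S_d0 q p \<in> carrier_mat 3 (Suc 0)"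
  by (simp add: S_d0_def generator_defs mat_lin_rows lin_ev)
    (simp add: S_d0_def mat_of_rows_list_def numeral_eq_Suc carrier_matI)

lemma mat_lin_s_d1: "mat_lin (S_d1 q p)" "S_d1 q p \<in> carrier_mat 4 3"
  by (simp add: S_d1_def generator_defs mat_lin_rows lin_ev)
    (simp add: S_d1_def mat_of_rows_list_def numeral_eq_Suc carrier_matI)

lemma mat_lin_s_d2: "mat_lin (S_d2 q p)" "S_d2 q p \<in> carrier_mat 4 4"
  by (simp add: S_d2_def generator_defs mat_lin_rows lin_ev)
    (simp add: S_d2_def mat_of_rows_list_def numeral_eq_Suc carrier_matI)

lemma mat_lin_s_d3: "mat_lin (S_d3 q p)" "S_d3 q p \<in> carrier_mat 4 4"
  by (simp add: S_d3_def generator_defs mat_lin_rows lin_ev)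
    (simp add: S_d3_def mat_of_rows_list_def numeral_eq_Suc carrier_matI)

lemma mat_lin_t_d1: "mat_lin (T_d1 q p)" "T_d1 q p \<in> carrier_mat (Suc 0) 3"
  by (simp add: T_d1_def generator_defs mat_lin_rows lin_ev)
    (simp add: T_d1_def mat_of_rows_list_def numeral_eq_Suc carrier_matI)

lemma mat_lin_t_d2: "mat_lin (T_d2 q p)" "T_d2 q p \<in> carrier_mat 3 4"
  by (simp add: T_d2_def generator_defs mat_lin_rows lin_ev)
    (simp add: T_d2_def mat_of_rows_list_def numeral_eq_Suc carrier_matI)

lemma mat_lin_t_d3: "mat_lin (T_d3 q p)" "T_d3 q p \<in> carrier_mat 4 4"
  by (simp add: T_d3_def generator_defs mat_lin_rows lin_ev)
    (simp add: T_d3_def mat_of_rows_list_def numeral_eq_Suc carrier_matI)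

lemma mat_lin_t_d4: "mat_lin (T_d4 q p)" "T_d4 q p \<in> carrier_mat 4 4"
  by (simp add: T_d4_def generator_defs mat_lin_rows lin_ev)
    (simp add: T_d4_def mat_of_rows_list_def numeral_eq_Suc carrier_matI)

lemma mat_lin_g_0: "mat_lin (g_mat q p \<alpha> \<beta> 0)"
    "g_mat q p \<alpha> \<beta> 0 \<in> carrier_mat 4 (Suc 0)"
  by (simp add: g_mat_def generator_defs mat_lin_rows lin_ev)
    (simp add: g_mat_def mat_of_rows_list_def numeral_eq_Suc carrier_matI)

lemma mat_lin_g_1: "mat_lin (g_mat q p \<alpha> \<beta> 1)" "g_mat q p \<alpha> \<beta> 1 \<in> carrier_mat 3 3"
  by (simp add: g_mat_def generator_defs mat_lin_rows lin_ev)
    (simp add: g_mat_def mat_of_rows_list_def numeral_eq_Suc carrier_matI)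

lemma mat_lin_g_2: "mat_lin (g_mat q p \<alpha> \<beta> 2)"
    "g_mat q p \<alpha> \<beta> 2 \<in> carrier_mat (Suc 0) 4"
  by (simp add: g_mat_def generator_defs mat_lin_rows lin_ev)
    (simp add: g_mat_def mat_of_rows_list_def numeral_eq_Suc carrier_matI)

lemma mat_lin_f_0: "mat_lin (f_mat q p 0)" "f_mat q p 0 \<in> carrier_mat (Suc 0) 4"
  by (simp add: f_mat_def generator_defs mat_lin_rows lin_ev)
    (simp add: f_mat_def mat_of_rows_list_def numeral_eq_Suc carrier_matI)

lemma mat_lin_f_1: "mat_lin (f_mat q p 1)" "f_mat q p 1 \<in> carrier_mat 3 3"
  by (simp add: f_mat_def generator_defs mat_lin_rows lin_ev)
    (simp add: f_mat_def mat_of_rows_list_def numeral_eq_Suc carrier_matI)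

lemma mat_lin_f_2: "mat_lin (f_mat q p 2)" "f_mat q p 2 \<in> carrier_mat 4 (Suc 0)"
  by (simp add: f_mat_def generator_defs mat_lin_rows lin_ev)
    (simp add: f_mat_def mat_of_rows_list_def numeral_eq_Suc carrier_matI)

lemma mat_lin_s_h1: "mat_lin (S_h1)" "S_h1 \<in> carrier_mat (Suc 0) 3"
  by (simp add: S_h1_def generator_defs mat_lin_rows lin_ev)
    (simp add: S_h1_def mat_of_rows_list_def numeral_eq_Suc carrier_matI)

lemma mat_lin_s_h2: "mat_lin (S_h2)" "S_h2 \<in> carrier_mat 3 4"
  by (simp add: S_h2_def generator_defs mat_lin_rows lin_ev)
    (simp add: S_h2_def mat_of_rows_list_def numeral_eq_Suc carrier_matI)

lemma mat_lin_s_h3: "mat_lin (S_h3)" "S_h3 \<in> carrier_mat 4 4"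
  by (simp add: S_h3_def generator_defs mat_lin_rows lin_ev)
    (simp add: S_h3_def mat_of_rows_list_def numeral_eq_Suc carrier_matI)

lemma mat_lin_s_h4: "mat_lin (S_h4)" "S_h4 \<in> carrier_mat 4 4"
  by (simp add: S_h4_def generator_defs mat_lin_rows lin_ev)
    (simp add: S_h4_def mat_of_rows_list_def numeral_eq_Suc carrier_matI)

lemma mat_lin_t_h0: "mat_lin (T_h0)" "T_h0 \<in> carrier_mat 3 (Suc 0)"
  by (simp add: T_h0_def generator_defs mat_lin_rows lin_ev)
    (simp add: T_h0_def mat_of_rows_list_def numeral_eq_Suc carrier_matI)

lemma mat_lin_t_h1: "mat_lin (T_h1)" "T_h1 \<in> carrier_mat 4 3"
  by (simp add: T_h1_def generator_defs mat_lin_rows lin_ev)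
    (simp add: T_h1_def mat_of_rows_list_def numeral_eq_Suc carrier_matI)

lemma mat_lin_t_h2: "mat_lin (T_h2)" "T_h2 \<in> carrier_mat 4 4"
  by (simp add: T_h2_def generator_defs mat_lin_rows lin_ev)
    (simp add: T_h2_def mat_of_rows_list_def numeral_eq_Suc carrier_matI)

lemma mat_lin_t_h3: "mat_lin (T_h3)" "T_h3 \<in> carrier_mat 4 4"
  by (simp add: T_h3_def generator_defs mat_lin_rows lin_ev)
    (simp add: T_h3_def mat_of_rows_list_def numeral_eq_Suc carrier_matI)

end

section \<open>The complexes and the homotopies\<close>

lemma vec_of_list_zero:
  "vec_of_list [0] = 0\<^sub>v 1" "vec_of_list [0, 0, 0] = 0\<^sub>v 3" "vec_of_list [0, 0, 0, 0] = 0\<^sub>v 4"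
  by (rule eq_vecI; simp add: vec_of_list_index nth_Cons' del: vec_of_list_Cons)+

lemma vec_of_list_plus:
  "length xs = length ys \<Longrightarrow> vec_of_list (map2 (+) xs ys) = vec_of_list xs + vec_of_list ys"
  by (intro eq_vecI) (simp_all add: vec_of_list_index del: vec_of_list_map)

lemma vec_of_list_nth:
  "length v = Suc 0 \<Longrightarrow> vec_of_list [v!0] = vec_of_list v"
  "length v = 3 \<Longrightarrow> vec_of_list [v!0, v!Suc 0, v!2] = vec_of_list v"
  "length v = 4 \<Longrightarrow> vec_of_list [v!0, v!Suc 0, v!2, v!3] = vec_of_list v"
  by (rule arg_cong[of _ _ vec_of_list], rule nth_equalityI; force simp: nth_Cons' numeral_eq_Suc less_Suc_eq)+

text \<open>Settles equations in degrees where the module is zero.\<close>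

lemma vec_eq_0: "v \<in> carrier_vec 0 \<Longrightarrow> w \<in> carrier_vec 0 \<Longrightarrow> v = w"
  by auto

lemma vec_of_listE:
  assumes "v \<in> carrier_vec n"
  obtains xs where "v = vec_of_list xs" "length xs = n"
  using assms that[of "list_of_vec v"] by (auto simp: vec_list)

context gwa_smooth_module
begin

abbreviation "K \<equiv> ring_of_type_algebra :: 'k ring"
abbreviation "MA \<equiv> mat_act (gscal q p) lact ract"
abbreviation "VM \<equiv> vec_module (gscal q p) lact"

lemma lact_gscal: "lact (gscal q p c) = act (cst c)"
  by (simp add: fun_eq_iff gscal_def act_cst scalar_L_R[symmetric] L_def)

lemma vec_module_sel:
  "carrier (VM n) = carrier_vec n" "zero (VM n) = 0\<^sub>v n" "add (VM n) = (+)"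
  "module.smult (VM n) c = map_vec (act (cst c))"
  by (simp_all add: vec_module_def lact_gscal)

lemma module_vec_module: "Module.module K (VM n)"
proof -
  have "abelian_group (VM n)"
  proof (rule abelian_groupI)
    show "\<exists>y\<in>carrier (VM n). y \<oplus>\<^bsub>VM n\<^esub> x = \<zero>\<^bsub>VM n\<^esub>" if "x \<in> carrier (VM n)" for x
      using that by (intro bexI[of _ "- x"]) (auto simp: vec_module_sel)
  qed (auto simp: vec_module_sel intro: comm_add_vec assoc_add_vec)
  then show ?thesis
    unfolding Module.module_def module_axioms_def
    by (auto simp: vec_module_sel cring_from_type_algebra intro!: eq_vecI
        simp: cst.hom_add cst.hom_mult act_mult scale_left_distrib scale_right_distrib)
qed

lemma lin_sum: "lin h \<Longrightarrow> h (sum k I) = (\<Sum>i\<in>I. h (k i))"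
  using additive_zero[of h] by (induction I rule: infinite_finite_induct) (auto simp: lin_def)

lemma mat_act_lin_hom:
  assumes "mat_lin N" "N \<in> carrier_mat a b"
  shows "MA N \<in> lin_hom K (VM b) (VM a)"
proof -
  have l: "lin (ev (N $$ (i, j)))" if "i < a" "j < b" for i j
    using assms that by (auto simp: mat_lin_def)
  show ?thesis
    using assms(2) l
    by (auto simp: lin_hom_def vec_module_sel mat_act_def lin_sum[OF lin_act] lin_def sum.distrib[symmetric]
        intro!: eq_vecI sum.cong)
qed

lemma MA_zero_left: "MA (0\<^sub>m a b) v = 0\<^sub>v a"
  by (intro eq_vecI) (auto simp: mat_act_def)

lemma MA_zero_right:
  assumes "mat_lin N" "N \<in> carrier_mat a b"
  shows "MA N (0\<^sub>v b) = 0\<^sub>v a"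
  using assms additive_zero by (intro eq_vecI) (auto simp: mat_act_def mat_lin_def lin_def intro!: sum.neutral)

lemma S_mat_carrier: "S_mat q p i \<in> carrier_mat (S_rank (i + 1)) (S_rank i)"
  and S_mat_lin: "mat_lin (S_mat q p i)"
  by (auto simp: S_mat_def S_rank_def mat_lin_s_d0 mat_lin_s_d1 mat_lin_s_d2 mat_lin_s_d3 mat_lin_zero)

lemma T_mat_carrier: "T_mat q p i \<in> carrier_mat (T_rank (i + 1)) (T_rank i)"
  and T_mat_lin: "mat_lin (T_mat q p i)"
  by (auto simp: T_mat_def T_rank_def mat_lin_t_d1 mat_lin_t_d2 mat_lin_t_d3 mat_lin_t_d4 mat_lin_zero)

lemma f_mat_zero: "i \<noteq> 0 \<Longrightarrow> i \<noteq> 1 \<Longrightarrow> i \<noteq> 2 \<Longrightarrow> f_mat q p i = 0\<^sub>m (S_rank i) (T_rank (i - 2))"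
  by (simp add: f_mat_def)

lemma g_mat_zero: "i \<noteq> 0 \<Longrightarrow> i \<noteq> 1 \<Longrightarrow> i \<noteq> 2 \<Longrightarrow> g_mat q p \<alpha> \<beta> i = 0\<^sub>m (T_rank (i - 2)) (S_rank i)"
  by (simp add: g_mat_def)

lemma f_mat_carrier: "f_mat q p i \<in> carrier_mat (S_rank i) (T_rank (i - 2))"
  and f_mat_lin: "mat_lin (f_mat q p i)"
proof -
  consider "i = 0" | "i = 1" | "i = 2" | "i \<noteq> 0" "i \<noteq> 1" "i \<noteq> 2" by blast
  then have "f_mat q p i \<in> carrier_mat (S_rank i) (T_rank (i - 2)) \<and> mat_lin (f_mat q p i)"
    by cases (simp_all add: S_rank_def T_rank_def mat_lin_f_0 mat_lin_f_1 mat_lin_f_2 f_mat_zero mat_lin_zero)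
  then show "f_mat q p i \<in> carrier_mat (S_rank i) (T_rank (i - 2))" "mat_lin (f_mat q p i)" by auto
qed

lemma g_mat_carrier: "g_mat q p \<alpha> \<beta> i \<in> carrier_mat (T_rank (i - 2)) (S_rank i)"
  and g_mat_lin: "mat_lin (g_mat q p \<alpha> \<beta> i)"
proof -
  consider "i = 0" | "i = 1" | "i = 2" | "i \<noteq> 0" "i \<noteq> 1" "i \<noteq> 2" by blast
  then have "g_mat q p \<alpha> \<beta> i \<in> carrier_mat (T_rank (i - 2)) (S_rank i) \<and> mat_lin (g_mat q p \<alpha> \<beta> i)"
    by cases (simp_all add: S_rank_def T_rank_def mat_lin_g_0 mat_lin_g_1 mat_lin_g_2 g_mat_zero mat_lin_zero)
  then show "g_mat q p \<alpha> \<beta> i \<in> carrier_mat (T_rank (i - 2)) (S_rank i)" "mat_lin (g_mat q p \<alpha> \<beta> i)" by auto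
qed

definition S_h :: "int \<Rightarrow> 'k env_mat" where
  "S_h i = (if i \<le> 0 then 0\<^sub>m (S_rank (i - 1)) (S_rank i) else if i = 1 then S_h1 else if i = 2 then S_h2
     else if odd i then S_h3 else S_h4)"

definition T_h :: "int \<Rightarrow> 'k env_mat" where
  "T_h i = (if i > 0 then 0\<^sub>m (T_rank (i - 1)) (T_rank i) else if i = 0 then T_h0 else if i = - 1 then T_h1
     else if even i then T_h2 else T_h3)"

lemma S_h_carrier: "S_h i \<in> carrier_mat (S_rank (i - 1)) (S_rank i)"
  and S_h_lin: "mat_lin (S_h i)"
  by (auto simp: S_h_def S_rank_def mat_lin_s_h1 mat_lin_s_h2 mat_lin_s_h3 mat_lin_s_h4 mat_lin_zero)

lemma T_h_carrier: "T_h i \<in> carrier_mat (T_rank (i - 1)) (T_rank i)"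
  and T_h_lin: "mat_lin (T_h i)"
  by (auto simp: T_h_def T_rank_def mat_lin_t_h0 mat_lin_t_h1 mat_lin_t_h2 mat_lin_t_h3 mat_lin_zero)

lemma length_diff:
  "length (s_d0 v) = 3" "length (s_d1 v) = 4" "length (s_d2 v) = 4" "length (s_d3 v) = 4"
  "length (t_d1 v) = 1" "length (t_d2 v) = 3" "length (t_d3 v) = 4" "length (t_d4 v) = 4"
  "length (s_h1 v) = 1" "length (s_h2 v) = 3" "length (s_h3 v) = 4" "length (s_h4 v) = 4"
  "length (t_h0 v) = 3" "length (t_h1 v) = 4" "length (t_h2 v) = 4" "length (t_h3 v) = 4"
  by (simp_all add: s_d0_def s_d1_def s_d2_def s_d3_def t_d1_def t_d2_def t_d3_def t_d4_def
      s_h1_def s_h2_def s_h3_def s_h4_def t_h0_def t_h1_def t_h2_def t_h3_def)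

lemmas mat_act_vec_of_list =
  mat_act_s_d0 mat_act_s_d1 mat_act_s_d2 mat_act_s_d3 mat_act_t_d1 mat_act_t_d2 mat_act_t_d3 mat_act_t_d4
  mat_act_s_h1 mat_act_s_h2 mat_act_s_h3 mat_act_s_h4 mat_act_t_h0 mat_act_t_h1 mat_act_t_h2 mat_act_t_h3
  mat_act_f_0 mat_act_f_1 mat_act_f_2 mat_act_g_0 mat_act_g_1 mat_act_g_2

lemma S_mat_S_mat:
  assumes "v \<in> carrier_vec (S_rank i)"
  shows "MA (S_mat q p (i + 1)) (MA (S_mat q p i) v) = 0\<^sub>v (S_rank (i + 2))"
proof -
  obtain xs where v: "v = vec_of_list xs" "length xs = S_rank i" using assms by (rule vec_of_listE)
  consider "i < 0" | "i = 0" | "i = 1" | "i \<ge> 2" "even i" | "i \<ge> 2" "odd i" by linarith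
  then show ?thesis
  proof cases
    \<comment> \<open>This includes \<open>i = -1\<close>, where the second matrix is
      \<open>S_d0\<close>; hence the zero vector is pushed through a linear map.\<close>
    case 1
    then have "MA (S_mat q p i) v = 0\<^sub>v (S_rank (i + 1))" by (simp add: S_mat_def MA_zero_left)
    then show ?thesis using MA_zero_right[OF S_mat_lin S_mat_carrier[of "i + 1"]] by (simp add: add.assoc)
  qed (simp_all add: v S_mat_def S_rank_def mat_act_vec_of_list vec_of_list_zero
      s_d1_s_d0 s_d2_s_d1 s_d3_s_d2 s_d2_s_d3 del: vec_of_list_Cons)
qed

lemma T_mat_T_mat:
  assumes "v \<in> carrier_vec (T_rank i)"
  shows "MA (T_mat q p (i + 1)) (MA (T_mat q p i) v) = 0\<^sub>v (T_rank (i + 2))"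
proof -
  obtain xs where v: "v = vec_of_list xs" "length xs = T_rank i" using assms by (rule vec_of_listE)
  consider "i \<ge> - 1" | "i = - 2" | "i = - 3" | "i \<le> - 4" "even i" | "i \<le> - 4" "odd i" by linarith
  then show ?thesis
    by cases (simp_all add: v T_mat_def T_rank_def mat_act_vec_of_list vec_of_list_zero MA_zero_left
      t_d1_t_d2 t_d2_t_d3 t_d3_t_d4 t_d4_t_d3 add.assoc del: vec_of_list_Cons)
qed

abbreviation "S \<equiv> S_complex q p lact ract"
abbreviation "T \<equiv> cshift (T_complex q p lact ract) (- 2)"

lemma S_sel: "cobj S i = VM (S_rank i)" "cdiff S i = MA (S_mat q p i)"
  and T_sel: "cobj T i = VM (T_rank (i - 2))" "cdiff T i = MA (T_mat q p (i - 2))"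
  by (simp_all add: S_complex_def T_complex_def cshift_def)

lemma cochain_complex_S: "cochain_complex K S"
  unfolding cochain_complex_def S_sel vec_module_sel
  using module_vec_module mat_act_lin_hom[OF S_mat_lin S_mat_carrier] S_mat_S_mat by blast

lemma cochain_complex_T: "cochain_complex K T"
  unfolding cochain_complex_def T_sel vec_module_sel
  using module_vec_module mat_act_lin_hom[OF T_mat_lin T_mat_carrier, of "i - 2" for i] T_mat_T_mat[of _ "i - 2" for i]
  by (simp add: algebra_simps)

lemma cochain_map_g: "cochain_map K S T (g_map q p \<alpha> \<beta> lact ract)"
  unfolding cochain_map_def S_sel T_sel vec_module_sel g_map_def
proof (intro conjI allI ballI)
  show "MA (g_mat q p \<alpha> \<beta> i) \<in> lin_hom K (VM (S_rank i)) (VM (T_rank (i - 2)))" for i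
    by (rule mat_act_lin_hom[OF g_mat_lin g_mat_carrier])
next
  fix i :: int and v :: "'m vec" assume v: "v \<in> carrier_vec (S_rank i)"
  obtain xs where xs: "v = vec_of_list xs" "length xs = S_rank i" using v by (rule vec_of_listE)
  have z: "MA (T_mat q p (i - 2)) (0\<^sub>v (T_rank (i - 2))) = 0\<^sub>v (T_rank (i - 2 + 1))"
    by (rule MA_zero_right[OF T_mat_lin T_mat_carrier])
  consider "i < - 1" | "i = - 1" | "i = 0" | "i = 1" | "i \<ge> 2" by linarith
  then show "MA (g_mat q p \<alpha> \<beta> (i + 1)) (MA (S_mat q p i) v) = MA (T_mat q p (i - 2)) (MA (g_mat q p \<alpha> \<beta> i) v)"
  proof cases
    case 1
    then show ?thesis using z by (simp add: g_mat_def MA_zero_left algebra_simps)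
  next
    \<comment> \<open>The source is zero, but \<open>g\<close> in degree 0 and \<open>T_mat\<close>
      are not, so both must be applied to a zero vector.\<close>
    case 2
    then show ?thesis using z MA_zero_right[OF g_mat_lin g_mat_carrier, of 0]
      by (simp add: g_mat_def[of _ _ _ _ "- 1"] MA_zero_left S_mat_def S_rank_def)
  next
    \<comment> \<open>The target lies above the top degree of the shifted complex, hence is
      zero.\<close>
    case 5
    then show ?thesis by (intro vec_eq_0) (auto simp: mat_act_def T_mat_def g_mat_def T_rank_def)
  qed (simp_all add: xs S_mat_def T_mat_def mat_act_vec_of_list g_1_s_d0 g_2_s_d1)
qed

lemma cochain_map_f: "cochain_map K T S (f_map q p lact ract)"
  unfolding cochain_map_def S_sel T_sel vec_module_sel f_map_def
proof (intro conjI allI ballI)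
  show "MA (f_mat q p i) \<in> lin_hom K (VM (T_rank (i - 2))) (VM (S_rank i))" for i
    by (rule mat_act_lin_hom[OF f_mat_lin f_mat_carrier])
next
  fix i :: int and v :: "'m vec" assume v: "v \<in> carrier_vec (T_rank (i - 2))"
  obtain xs where xs: "v = vec_of_list xs" "length xs = T_rank (i - 2)" using v by (rule vec_of_listE)
  have z: "MA (S_mat q p i) (0\<^sub>v (S_rank i)) = 0\<^sub>v (S_rank (i + 1))"
    by (rule MA_zero_right[OF S_mat_lin S_mat_carrier])
  consider "i < - 1" | "i = - 1" | "i = 0" | "i = 1" | "i = 2" | "i > 2" by linarith
  then show "MA (f_mat q p (i + 1)) (MA (T_mat q p (i - 2)) v) = MA (S_mat q p i) (MA (f_mat q p i) v)"
  proof cases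
    case 1
    then show ?thesis using z by (simp add: f_mat_def MA_zero_left)
  next
    case 2
    then show ?thesis
      by (simp add: xs S_mat_def T_mat_def mat_act_vec_of_list MA_zero_left f_0_t_d3 vec_of_list_zero S_rank_def
          del: vec_of_list_Cons)
  next
    case 5
    then show ?thesis
      by (simp add: xs S_mat_def f_mat_def[of _ _ 3] mat_act_vec_of_list MA_zero_left s_d2_f_2 vec_of_list_zero S_rank_def
          del: vec_of_list_Cons)
  next
    case 6
    then show ?thesis using z by (simp add: f_mat_def MA_zero_left)
  qed (simp_all add: xs S_mat_def T_mat_def mat_act_vec_of_list f_1_t_d2 f_2_t_d1)
qed

lemmas homotopies =
  homotopy_s_0 homotopy_s_1 homotopy_s_2
  homotopy_s_odd homotopy_s_even homotopy_t_0 homotopy_t_1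
  homotopy_t_2 homotopy_t_odd homotopy_t_even

lemma carrier_vec_of_list: "length xs = n \<Longrightarrow> vec_of_list xs \<in> carrier_vec n"
  by (simp add: carrier_vecI)

lemmas zero_sum = left_zero_vec[OF carrier_vec_of_list] right_zero_vec[OF carrier_vec_of_list]

lemma homotopic_fg:
  "homotopic_maps K S S (\<lambda>i v. f_map q p lact ract i (g_map q p \<alpha> \<beta> lact ract i v)) (\<lambda>i v. v)"
  unfolding homotopic_maps_def S_sel vec_module_sel g_map_def f_map_def
proof (intro exI conjI allI ballI)
  show "MA (S_h i) \<in> lin_hom K (VM (S_rank i)) (VM (S_rank (i - 1)))" for i
    by (rule mat_act_lin_hom[OF S_h_lin S_h_carrier])
next
  fix i :: int and v :: "'m vec" assume v: "v \<in> carrier_vec (S_rank i)"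
  obtain xs where xs: "v = vec_of_list xs" "length xs = S_rank i" using v by (rule vec_of_listE)
  note simps = xs S_mat_def S_h_def S_rank_def mat_act_vec_of_list MA_zero_left homotopies length_diff
    vec_of_list_plus vec_of_list_nth zero_sum
  consider "i < 0" | "i = 0" | "i = 1" | "i = 2" | "i \<ge> 3" "even i" | "i \<ge> 3" "odd i" by linarith
  then show "MA (f_mat q p i) (MA (g_mat q p \<alpha> \<beta> i) v)
    = v + (MA (S_mat q p (i - 1)) (MA (S_h i) v) + MA (S_h (i + 1)) (MA (S_mat q p i) v))"
  proof cases
    case 1
    then show ?thesis using v
      by (intro vec_eq_0) (auto simp: mat_act_def S_mat_def f_mat_def S_rank_def S_h_def)
  next
    case 5
    \<comment> \<open>The zero vector is written as a list because \<open>homotopy_s_even\<close>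
      rewrites exactly these four zeros into the homotopy formula.\<close>
    then have "MA (f_mat q p i) (MA (g_mat q p \<alpha> \<beta> i) v) = vec_of_list [0, 0, 0, 0]"
      by (simp add: f_mat_def MA_zero_left vec_of_list_zero S_rank_def del: vec_of_list_Cons)
    with 5 show ?thesis
      using xs(2) by (simp add: homotopy_s_even[of xs] simps del: vec_of_list_Cons vec_of_list_map)
  next
    case 6
    then have "MA (f_mat q p i) (MA (g_mat q p \<alpha> \<beta> i) v) = vec_of_list [0, 0, 0, 0]"
      by (simp add: f_mat_def MA_zero_left vec_of_list_zero S_rank_def del: vec_of_list_Cons)
    with 6 show ?thesis
      using xs(2) by (simp add: homotopy_s_odd[of xs] simps del: vec_of_list_Cons vec_of_list_map)
  qed (use xs(2) in \<open>simp_all add: simps del: vec_of_list_Cons vec_of_list_map\<close>)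
qed

text \<open>Degree \<open>i\<close> of the shifted complex is degree \<open>i - 2\<close> of the
  original one, so the homotopy is \<open>T_h (i - 2)\<close>.\<close>

lemma homotopic_gf:
  "homotopic_maps K T T (\<lambda>i v. g_map q p \<alpha> \<beta> lact ract i (f_map q p lact ract i v)) (\<lambda>i v. v)"
  unfolding homotopic_maps_def T_sel vec_module_sel g_map_def f_map_def
proof (intro exI conjI allI ballI)
  show "MA (T_h (i - 2)) \<in> lin_hom K (VM (T_rank (i - 2))) (VM (T_rank (i - 1 - 2)))" for i
    using mat_act_lin_hom[OF T_h_lin T_h_carrier, of "i - 2"] by (simp add: algebra_simps)
next
  fix i :: int and v :: "'m vec" assume v: "v \<in> carrier_vec (T_rank (i - 2))"
  obtain xs where xs: "v = vec_of_list xs" "length xs = T_rank (i - 2)" using v by (rule vec_of_listE)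
  note simps = xs T_mat_def T_h_def T_rank_def mat_act_vec_of_list MA_zero_left homotopies length_diff
    vec_of_list_plus vec_of_list_nth zero_sum
  consider "i > 2" | "i = 2" | "i = 1" | "i = 0" | "i < 0" "even i" | "i < 0" "odd i" by linarith
  then show "MA (g_mat q p \<alpha> \<beta> i) (MA (f_mat q p i) v)
    = v + (MA (T_mat q p (i - 1 - 2)) (MA (T_h (i - 2)) v) + MA (T_h (i + 1 - 2)) (MA (T_mat q p (i - 2)) v))"
  proof cases
    case 1
    then show ?thesis using v
      by (intro vec_eq_0) (auto simp: mat_act_def T_mat_def g_mat_def T_rank_def T_h_def)
  next
    case 5
    then have "MA (g_mat q p \<alpha> \<beta> i) (MA (f_mat q p i) v) = vec_of_list [0, 0, 0, 0]"
      by (simp add: g_mat_def MA_zero_left vec_of_list_zero T_rank_def del: vec_of_list_Cons)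
    with 5 show ?thesis
      using xs(2) by (simp add: homotopy_t_even[of xs] simps del: vec_of_list_Cons vec_of_list_map)
  next
    case 6
    then have "MA (g_mat q p \<alpha> \<beta> i) (MA (f_mat q p i) v) = vec_of_list [0, 0, 0, 0]"
      by (simp add: g_mat_def MA_zero_left vec_of_list_zero T_rank_def del: vec_of_list_Cons)
    with 6 show ?thesis
      using xs(2) by (simp add: homotopy_t_odd[of xs] simps del: vec_of_list_Cons vec_of_list_map)
  qed (use xs(2) in \<open>simp_all add: simps del: vec_of_list_Cons vec_of_list_map\<close>)
qed

end

theorem theorem1:
  fixes q :: "'k :: field" and p \<alpha> \<beta> :: "'k poly"
    and lact :: "'k free_alg set \<Rightarrow> 'm :: ab_group_add \<Rightarrow> 'm"
    and ract :: "'m \<Rightarrow> 'k free_alg set \<Rightarrow> 'm"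
  assumes "CHAR('k) \<noteq> 2"
    and "q \<noteq> 0" and "q \<noteq> 1"
    and "Polynomial.degree p \<ge> 1"
    and "coprime p (pderiv p)"
    and "\<alpha> * p + \<beta> * pderiv p = 1"
    and "gwa_bimodule q p lact ract"
  shows "let K = (ring_of_type_algebra :: 'k ring);
             S = S_complex q p lact ract;
             T = cshift (T_complex q p lact ract) (-2);
             f = f_map q p lact ract;
             g = g_map q p \<alpha> \<beta> lact ract
         in cochain_complex K S \<and> cochain_complex K T \<and>
            cochain_map K S T g \<and> cochain_map K T S f \<and>
            homotopic_maps K S S (\<lambda>i v. f i (g i v)) (\<lambda>i v. v) \<and>
            homotopic_maps K T T (\<lambda>i v. g i (f i v)) (\<lambda>i v. v) \<and>
            quasi_isomorphism K T S f \<and> quasi_isomorphism K S T g"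
proof -
  interpret gwa_smooth_module q p lact ract \<alpha> \<beta>
    using assms by unfold_locales simp_all
  show ?thesis
    unfolding Let_def
    using cochain_complex_S cochain_complex_T cochain_map_g cochain_map_f homotopic_fg homotopic_gf
      homotopy_equivalence_quasi_isomorphism by blast
qed

end
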